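(* For every $Y\in\{\text{TJ},\text{TS},\text{TAR}\}$, the problem G-OA-Reconf-$Y$ (reconfiguration of global offensive alliances), parameterized by $k$, is fixed-parameter tractable.
   Context: For $A\subseteq V$: $N[A]=A\cup\bigcup_{v\in A}N(v)$, $\partial A=N[A]\setminus A$, $d_A(v)=|N(v)\cap A|$. $A$ is an offensive alliance if $d_A(v)\ge d_{V\setminus A}(v)+1$ for all $v\in\partial A$; a global offensive alliance is an offensive alliance that is a dominating set. Steps: token jumping (TJ): $|A|=|B|$, $|A\setminus B|=1$; token sliding (TS): TJ step with the vertex of $A\setminus B$ adjacent to the vertex of $B\setminus A$; token addition/removal (TAR): one set arises from the other by adding one vertex. G-OA-Reconf-$Y$: given $G$, global offensive alliances $A_s,A_t$ (and $k$ if $Y=\text{TAR}$), decide whether there is a sequence $A_s=A_1,\dots,A_\ell=A_t$ of global offensive alliances (each of size at most $k$ if $Y=\text{TAR}$), consecutive sets differing by a $Y$ step. The parameter $k$ is $|A_s|=|A_t|$ for TJ/TS and the size threshold for TAR. *)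

theory Defs
  imports Main
begin

subsection \<open>Model of computation\<close>

text \<open>
  Algorithms are programs of a first-order, call-by-value functional language with recursion whose
  only data are binary trees (Jones' language F, ``Computability and Complexity'', 1997).
  Every evaluation rule costs one unit. Since trees are only taken apart, put together and tested
  for being a leaf, they can be shared, so that each rule takes constant time (depending only on
  the program) on a pointer machine; hence running times agree with those of Turing machines up to
  a polynomial.
\<close>

datatype tree = Leaf | Node tree tree

text \<open>
  Variables are de Bruijn indices into an environment; \<open>Let\<close> pushes a value in front of the
  environment, and the body of a called function sees exactly the list of argument values.
\<close>

datatype expr =
    Var nat
  | LeafE
  | NodeE expr expr
  | Left expr
  | Right expr
  | IfLeaf expr expr expr
  | LetE expr expr
  | Call nat "expr list"

text \<open>A program is the list of its function bodies; function \<open>0\<close> is the entry point.\<close>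

type_synonym program = "expr list"

fun left :: "tree \<Rightarrow> tree" where
  "left Leaf = Leaf"
| "left (Node a b) = a"

fun right :: "tree \<Rightarrow> tree" where
  "right Leaf = Leaf"
| "right (Node a b) = b"

inductive eval :: "program \<Rightarrow> tree list \<Rightarrow> expr \<Rightarrow> tree \<Rightarrow> nat \<Rightarrow> bool"
  and evals :: "program \<Rightarrow> tree list \<Rightarrow> expr list \<Rightarrow> tree list \<Rightarrow> nat \<Rightarrow> bool"
  for P :: program
where
  Var: "i < length env \<Longrightarrow> eval P env (Var i) (env ! i) 1"
| LeafE: "eval P env LeafE Leaf 1"
| NodeE: "eval P env e1 a s \<Longrightarrow> eval P env e2 b t \<Longrightarrow> eval P env (NodeE e1 e2) (Node a b) (s + t + 1)"
| Left: "eval P env e a t \<Longrightarrow> eval P env (Left e) (left a) (t + 1)"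
| Right: "eval P env e a t \<Longrightarrow> eval P env (Right e) (right a) (t + 1)"
| IfLeaf: "eval P env c Leaf s \<Longrightarrow> eval P env e1 a t \<Longrightarrow> eval P env (IfLeaf c e1 e2) a (s + t + 1)"
| IfNode: "eval P env c (Node u v) s \<Longrightarrow> eval P env e2 a t \<Longrightarrow>
    eval P env (IfLeaf c e1 e2) a (s + t + 1)"
| LetE: "eval P env e1 a s \<Longrightarrow> eval P (a # env) e2 b t \<Longrightarrow> eval P env (LetE e1 e2) b (s + t + 1)"
| Call: "g < length P \<Longrightarrow> evals P env es as s \<Longrightarrow> eval P as (P ! g) b t \<Longrightarrow>
    eval P env (Call g es) b (s + t + 1)"
| Nil: "evals P env [] [] 0"
| Cons: "eval P env e a s \<Longrightarrow> evals P env es as t \<Longrightarrow> evals P env (e # es) (a # as) (s + t)"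

lemma eval_deterministic:
  "eval P env e a s \<Longrightarrow> eval P env e b t \<Longrightarrow> a = b \<and> s = t"
  "evals P env es as s \<Longrightarrow> evals P env es bs t \<Longrightarrow> as = bs \<and> s = t"
proof (induction arbitrary: b t and bs t rule: eval_evals.inducts)
  case (Var i env)
  then show ?case by (auto elim: eval.cases)
next
  case (LeafE env)
  then show ?case by (auto elim: eval.cases)
next
  case (NodeE env e1 a s e2 b t)
  from NodeE.prems show ?case by cases (use NodeE.IH in blast)
next
  case (Left env e a t)
  from Left.prems show ?case by cases (use Left.IH in blast)
next
  case (Right env e a t)
  from Right.prems show ?case by cases (use Right.IH in blast)
next
  case (IfLeaf env c s e1 a t e2)
  from IfLeaf.prems show ?case by cases (use IfLeaf.IH in blast)+
next
  case (IfNode env c u v s e2 a t e1)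
  from IfNode.prems show ?case by cases (use IfNode.IH in blast)+
next
  case (LetE env e1 a s e2 b t)
  from LetE.prems show ?case by cases (use LetE.IH in blast)
next
  case (Call g env es as s b t)
  from Call.prems show ?case by cases (use Call.IH in blast)
next
  case (Nil env)
  then show ?case by (auto elim: evals.cases)
next
  case (Cons env e a s es as t)
  from Cons.prems show ?case by cases (use Cons.IH in blast)
qed

definition runs :: "program \<Rightarrow> tree list \<Rightarrow> tree \<Rightarrow> nat \<Rightarrow> bool" where
  "runs P args r t \<longleftrightarrow> P \<noteq> [] \<and> eval P args (P ! 0) r t"

definition bool_tree :: "bool \<Rightarrow> tree" where
  "bool_tree b = (if b then Node Leaf Leaf else Leaf)"

fun list_tree :: "tree list \<Rightarrow> tree" where
  "list_tree [] = Leaf"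
| "list_tree (a # as) = Node a (list_tree as)"

definition string_tree :: "bool list \<Rightarrow> tree" where
  "string_tree x = list_tree (map bool_tree x)"

definition nat_tree :: "nat \<Rightarrow> tree" where
  "nat_tree n = list_tree (replicate n Leaf)"

definition computable :: "(nat \<Rightarrow> nat) \<Rightarrow> bool" where
  "computable f \<longleftrightarrow> (\<exists>P. \<forall>n. \<exists>t. runs P [nat_tree n] (nat_tree (f n)) t)"


subsection \<open>Fixed-parameter tractability\<close>

type_synonym parameterized_problem = "(bool list \<times> nat) set"

text \<open>
  The size of an instance counts the parameter in unary; the additional \<open>1\<close> only keeps the bound
  nonzero for the empty string with parameter \<open>0\<close>.
\<close>

definition instance_size :: "bool list \<Rightarrow> nat \<Rightarrow> nat" where
  "instance_size x k = length x + k + 1"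

definition fixed_parameter_tractable :: "parameterized_problem \<Rightarrow> bool" where
  "fixed_parameter_tractable L \<longleftrightarrow>
     (\<exists>P f c. computable f \<and>
        (\<forall>x k. \<exists>t \<le> f k * instance_size x k ^ c.
           runs P [string_tree x, nat_tree k] (bool_tree ((x, k) \<in> L)) t))"


subsection \<open>Global offensive alliances\<close>

text \<open>A graph is given by its vertex set \<open>V\<close> and its adjacency relation \<open>E\<close>.\<close>

definition simple_graph :: "'a set \<Rightarrow> 'a rel \<Rightarrow> bool" where
  "simple_graph V E \<longleftrightarrow> finite V \<and> E \<subseteq> V \<times> V \<and> sym E \<and> irrefl E"

definition nbh :: "'a rel \<Rightarrow> 'a \<Rightarrow> 'a set" where
  "nbh E v = {u. (v, u) \<in> E}"

definition closed_nbh :: "'a rel \<Rightarrow> 'a set \<Rightarrow> 'a set" where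
  "closed_nbh E A = A \<union> (\<Union>v\<in>A. nbh E v)"

definition boundary :: "'a rel \<Rightarrow> 'a set \<Rightarrow> 'a set" where
  "boundary E A = closed_nbh E A - A"

definition degree_in :: "'a rel \<Rightarrow> 'a set \<Rightarrow> 'a \<Rightarrow> nat" where
  "degree_in E A v = card (nbh E v \<inter> A)"

definition offensive_alliance :: "'a set \<Rightarrow> 'a rel \<Rightarrow> 'a set \<Rightarrow> bool" where
  "offensive_alliance V E A \<longleftrightarrow>
     A \<subseteq> V \<and> (\<forall>v\<in>boundary E A. degree_in E A v \<ge> degree_in E (V - A) v + 1)"

definition dominating_set :: "'a set \<Rightarrow> 'a rel \<Rightarrow> 'a set \<Rightarrow> bool" where
  "dominating_set V E A \<longleftrightarrow> A \<subseteq> V \<and> closed_nbh E A = V"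

definition global_offensive_alliance :: "'a set \<Rightarrow> 'a rel \<Rightarrow> 'a set \<Rightarrow> bool" where
  "global_offensive_alliance V E A \<longleftrightarrow> offensive_alliance V E A \<and> dominating_set V E A"


subsection \<open>Reconfiguration\<close>

datatype reconf_rule = TJ | TS | TAR

fun reconf_step :: "reconf_rule \<Rightarrow> 'a rel \<Rightarrow> 'a set \<Rightarrow> 'a set \<Rightarrow> bool" where
  "reconf_step TJ E A B \<longleftrightarrow> card A = card B \<and> card (A - B) = 1"
| "reconf_step TS E A B \<longleftrightarrow> card A = card B \<and> card (A - B) = 1 \<and>
     (\<exists>u v. A - B = {u} \<and> B - A = {v} \<and> (u, v) \<in> E)"
| "reconf_step TAR E A B \<longleftrightarrow> (\<exists>v. v \<notin> A \<and> B = insert v A) \<or> (\<exists>v. v \<notin> B \<and> A = insert v B)"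

definition goa_reconfigurable ::
    "reconf_rule \<Rightarrow> nat \<Rightarrow> 'a set \<Rightarrow> 'a rel \<Rightarrow> 'a set \<Rightarrow> 'a set \<Rightarrow> bool" where
  "goa_reconfigurable Y k V E S T \<longleftrightarrow>
     (\<exists>As. As \<noteq> [] \<and> hd As = S \<and> last As = T \<and>
        (\<forall>A\<in>set As. global_offensive_alliance V E A \<and> (Y = TAR \<longrightarrow> card A \<le> k)) \<and>
        successively (reconf_step Y E) As)"

text \<open>
  Instances over the vertex set \<open>{0,\<dots>,n-1}\<close> are written as bit strings: \<open>n\<close> in unary, terminated by
  \<open>False\<close>, then the adjacency matrix row by row and the characteristic vectors of \<open>S\<close> and \<open>T\<close>.
\<close>

definition encode :: "nat \<Rightarrow> nat rel \<Rightarrow> nat set \<Rightarrow> nat set \<Rightarrow> bool list" where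
  "encode n E S T =
     replicate n True @ [False] @
     concat (map (\<lambda>i. map (\<lambda>j. (i, j) \<in> E) [0..<n]) [0..<n]) @
     map (\<lambda>i. i \<in> S) [0..<n] @ map (\<lambda>i. i \<in> T) [0..<n]"

definition GOA_Reconf :: "reconf_rule \<Rightarrow> parameterized_problem" where
  "GOA_Reconf Y =
     {(encode n E S T, k) | n E S T k.
        simple_graph {..<n} E \<and>
        global_offensive_alliance {..<n} E S \<and> global_offensive_alliance {..<n} E T \<and>
        (Y \<in> {TJ, TS} \<longrightarrow> card S = k \<and> card T = k) \<and>
        goa_reconfigurable Y k {..<n} E S T}"

end

theory Submission
  imports Defs
begin

text \<open>
  Let all alliances have at most \<open>k\<close> vertices. A vertex of degree at least \<open>2 k\<close> (heavy) lies in
  every global offensive alliance. Among the others, only the bad vertices, without a majority of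
  heavy neighbours, impose a condition; each of them lies in or next to the non-heavy part of the
  start alliance, so there are at most \<open>2 k\<^sup>2\<close> of them. The bad vertices and their non-heavy neighbours
  form the core. Whether a set containing the heavy vertices is an alliance depends on its core
  part only, and monotonically, so the remaining vertices (idle) just store tokens. Tokens are
  indistinguishable, so under sliding all vertices of a connected component of the idle vertices are
  interchangeable if two such vertices, or vertices adjacent to them, count as adjacent; it
  suffices to keep \<open>k\<close> vertices of every component that is adjacent to the core. Jumping is sliding
  in a complete graph, and under addition/removal idle tokens can be dropped first. This leaves a
  kernel \<open>U\<close> of size polynomial in \<open>k\<close>, and the reachability problem on its subsets is solved in
  time polynomial in the instance and \<open>2 ^ card U\<close>.
\<close>

subsection \<open>Polynomial-time functions on encoded data\<close>

text \<open>The alliance condition says that every outside vertex has more than half of its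
  neighbours inside (\<open>global_offensive_alliance_iff\<close>). This is monotone in the set, and
  it forces an outside vertex to have degree below twice the size of the set, whence the threshold
  \<open>2 * k\<close>. The obstacle is the unbounded number of idle vertices: under sliding they
  cannot simply be deleted, because they form corridors, and a corridor may be blocked by other
  tokens. Reachability is therefore not decided on an induced subgraph but on the kernel with the
  contracted adjacency \<open>mac\<close>. Keeping \<open>k\<close> vertices of a component suffices
  because a token that enters finds at most \<open>k - 1\<close> tokens inside; components next to
  heavy vertices only are never entered or left, as heavy tokens never move. The kernel has O(k^5)
  vertices; the cruder bound \<open>2 ^ (5 * k + 5)\<close> is used since any computable function of
  \<open>k\<close> is allowed and repeated doubling is the only exponential that has to be
  programmed. Numbers are unary, so the budget \<open>2 ^ 2 ^ (5 * k + 5)\<close> can be handed to a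
  polynomial-time procedure as an input.\<close>

class enc =
  fixes enc :: "'a \<Rightarrow> tree"
  assumes enc_inject: "enc x = enc y \<Longrightarrow> x = y"

lemma enc_eq_iff [simp]: "enc x = enc y \<longleftrightarrow> x = y"
  by (auto dest: enc_inject)

lemma list_tree_inject: "list_tree xs = list_tree ys \<Longrightarrow> xs = ys"
proof (induction xs arbitrary: ys)
  case Nil
  then show ?case by (cases ys) auto
next
  case (Cons x xs)
  then show ?case by (cases ys) auto
qed

instantiation bool :: enc
begin
definition "enc = bool_tree"
instance by standard (auto simp: enc_bool_def bool_tree_def split: if_splits)
end

instantiation unit :: enc
begin
definition "enc (u :: unit) = Leaf"
instance by standard auto
end

instantiation nat :: enc
begin
definition "enc = nat_tree"
instance
proof
  fix x y :: nat
  assume "enc x = enc y"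
  then show "x = y"
    unfolding enc_nat_def nat_tree_def
    by (metis length_replicate list_tree_inject)
qed
end

instantiation prod :: (enc, enc) enc
begin
definition "enc p = Node (enc (fst p)) (enc (snd p))"
instance by standard (auto simp: enc_prod_def prod_eq_iff)
end

instantiation list :: (enc) enc
begin
definition "enc xs = list_tree (map enc xs)"
instance
proof
  fix x y :: "'a list"
  assume "enc x = enc y"
  then have "map enc x = map enc y"
    unfolding enc_list_def by (rule list_tree_inject)
  then show "x = y" by (simp add: inj_map_eq_map inj_on_def)
qed
end

lemma enc_simps [simp]:
  "enc (a, b) = Node (enc a) (enc b)"
  "enc [] = Leaf"
  "enc (x # xs) = Node (enc x) (enc xs)"
  "enc False = Leaf"
  "enc True = Node Leaf Leaf"
  "enc (0::nat) = Leaf"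
  "enc (Suc n) = Node Leaf (enc n)"
  "enc () = Leaf"
  by (simp_all add: enc_prod_def enc_list_def enc_bool_def bool_tree_def enc_nat_def
      nat_tree_def enc_unit_def)

text \<open>Only inner nodes count (\<open>size Leaf = 0\<close>), so the unary number
  \<open>n\<close> has size exactly \<open>n\<close>.\<close>

definition esize :: "'a::enc \<Rightarrow> nat" where
  "esize x = size (enc x)"

lemma esize_simps [simp]:
  "esize (x, y) = esize x + esize y + 1"
  "esize ([] :: 'a::enc list) = 0"
  "esize (x # xs) = esize x + esize xs + 1"
  by (simp_all add: esize_def)

lemma esize_bool [simp]: "esize (b :: bool) \<le> 1"
  by (cases b) (simp_all add: esize_def)

lemma esize_nat [simp]: "esize (n::nat) = n"
  by (induction n) (auto simp: esize_def)

lemma esize_append [simp]: "esize (xs @ ys) = esize xs + esize ys"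
  by (induction xs) auto

lemma length_le_esize: "length xs \<le> esize xs"
  by (induction xs) auto

lemma esize_elem: "x \<in> set xs \<Longrightarrow> esize x < esize xs"
  by (induction xs) auto

text \<open>The base is at least 2 even for inputs of size 0; a single exponent therefore absorbs
  all constants and coefficients.\<close>

definition poly_bounded :: "('a::enc \<Rightarrow> nat) \<Rightarrow> bool" where
  "poly_bounded T \<longleftrightarrow> (\<exists>c. \<forall>x. T x \<le> (esize x + 2) ^ c)"

lemma poly_bounded_mono: "poly_bounded T \<Longrightarrow> (\<And>x. U x \<le> T x) \<Longrightarrow> poly_bounded U"
  unfolding poly_bounded_def by (meson le_trans)

lemma poly_bounded_const: "poly_bounded (\<lambda>x. c)"
proof -
  have "c \<le> (n + 2) ^ c" for n
  proof -
    have "c < 2 ^ c" by (rule less_exp)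
    also have "\<dots> \<le> (n + 2) ^ c" by (rule power_mono) auto
    finally show ?thesis by simp
  qed
  then show ?thesis unfolding poly_bounded_def by blast
qed

lemma poly_bounded_esize: "poly_bounded (\<lambda>x. esize x)"
  unfolding poly_bounded_def by (rule exI[of _ 1]) auto

lemma poly_bounded_mult:
  assumes "poly_bounded T" "poly_bounded U"
  shows "poly_bounded (\<lambda>x. T x * U x)"
proof -
  from assms obtain c d where "\<And>x. T x \<le> (esize x + 2) ^ c" "\<And>x. U x \<le> (esize x + 2) ^ d"
    unfolding poly_bounded_def by blast
  then have "T x * U x \<le> (esize x + 2) ^ (c + d)" for x
    unfolding power_add by (rule mult_mono) auto
  then show ?thesis unfolding poly_bounded_def by blast
qed

text \<open>Sums reduce to products by \<open>T x + U x \<le> (T x + 1) * (U x + 1)\<close>, and the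
  summand 1 costs one more factor of a base that is at least 2.\<close>

lemma poly_bounded_add:
  assumes "poly_bounded T" "poly_bounded U"
  shows "poly_bounded (\<lambda>x. T x + U x)"
proof -
  have "poly_bounded (\<lambda>x. (T x + 1) * (U x + 1))" if "poly_bounded (\<lambda>x. T x + 1)" "poly_bounded (\<lambda>x. U x + 1)"
    using that by (rule poly_bounded_mult)
  moreover have "poly_bounded (\<lambda>x. T x + 1)" if "poly_bounded T" for T :: "'a \<Rightarrow> nat"
  proof -
    from that obtain c where c: "\<And>x. T x \<le> (esize x + 2) ^ c"
      unfolding poly_bounded_def by blast
    have "T x + 1 \<le> (esize x + 2) ^ Suc c" for x
    proof -
      have "T x + 1 \<le> (esize x + 2) ^ c + (esize x + 2) ^ c"
        using c[of x] by (intro add_mono) auto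
      also have "\<dots> \<le> (esize x + 2) ^ Suc c" by simp
      finally show ?thesis .
    qed
    then show ?thesis unfolding poly_bounded_def by blast
  qed
  ultimately have "poly_bounded (\<lambda>x. (T x + 1) * (U x + 1))" using assms by blast
  then show ?thesis by (rule poly_bounded_mono) (simp add: algebra_simps)
qed

lemma poly_bounded_comp:
  assumes "poly_bounded T" "poly_bounded (\<lambda>x. esize (g x))"
  shows "poly_bounded (\<lambda>x. T (g x))"
proof -
  obtain c where c: "\<And>y. T y \<le> (esize y + 2) ^ c"
    using assms(1) unfolding poly_bounded_def by blast
  have "poly_bounded (\<lambda>x. (esize (g x) + 2) ^ c)"
    by (induction c) (simp_all only: power_0 power_Suc, (intro poly_bounded_const poly_bounded_mult poly_bounded_add assms(2) | assumption)+)
  then show ?thesis by (rule poly_bounded_mono) (rule c)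
qed

section \<open>Relocating and linking programs\<close>

fun shift :: "nat \<Rightarrow> expr \<Rightarrow> expr" where
  "shift d (Var i) = Var i"
| "shift d LeafE = LeafE"
| "shift d (NodeE a b) = NodeE (shift d a) (shift d b)"
| "shift d (Left a) = Left (shift d a)"
| "shift d (Right a) = Right (shift d a)"
| "shift d (IfLeaf c a b) = IfLeaf (shift d c) (shift d a) (shift d b)"
| "shift d (LetE a b) = LetE (shift d a) (shift d b)"
| "shift d (Call g es) = Call (g + d) (map (shift d) es)"

text \<open>Only function indices depend on the position of a program inside a larger one. Variables
  refer to the environment of the current body, so values and costs survive relocation
  unchanged.\<close>

lemma eval_shift:
  assumes "\<And>i. i < length P \<Longrightarrow> Q ! (i + d) = shift d (P ! i)" "length P + d \<le> length Q"
  shows "eval P env e a t \<Longrightarrow> eval Q env (shift d e) a t"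
    and "evals P env es as t \<Longrightarrow> evals Q env (map (shift d) es) as t"
proof (induction rule: eval_evals.inducts)
  case (Call g env es as s b t)
  then have "eval Q env (Call (g + d) (map (shift d) es)) b (s + t + 1)"
    using assms by (intro eval_evals.intros) auto
  then show ?case by simp
qed (auto intro: eval_evals.intros simp del: One_nat_def add_Suc_right)

text \<open>Costs are upper bounds instead of exact values, so that bounds compose and can be
  weakened at any point.\<close>

definition ev :: "program \<Rightarrow> tree list \<Rightarrow> expr \<Rightarrow> tree \<Rightarrow> nat \<Rightarrow> bool" where
  "ev P env e a T \<longleftrightarrow> (\<exists>t\<le>T. eval P env e a t)"

definition evs :: "program \<Rightarrow> tree list \<Rightarrow> expr list \<Rightarrow> tree list \<Rightarrow> nat \<Rightarrow> bool" where
  "evs P env es as T \<longleftrightarrow> (\<exists>t\<le>T. evals P env es as t)"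

lemma ev_mono: "ev P env e a T \<Longrightarrow> T \<le> U \<Longrightarrow> ev P env e a U"
  unfolding ev_def by (meson le_trans)

text \<open>Entry point of symbolic execution: the rules applied next determine a value and a cost
  by unification, and the last two premises compare them with the claimed ones.\<close>

lemma ev_cong: "ev P env e a T \<Longrightarrow> a = b \<Longrightarrow> T \<le> U \<Longrightarrow> ev P env e b U"
  using ev_mono by blast

lemma ev_Var: "i < length env \<Longrightarrow> ev P env (Var i) (env ! i) 1"
  unfolding ev_def using eval_evals.Var by blast

lemma ev_LeafE: "ev P env LeafE Leaf 1"
  unfolding ev_def using eval_evals.LeafE by blast

lemma ev_NodeE:
  "ev P env e1 a s \<Longrightarrow> ev P env e2 b t \<Longrightarrow> ev P env (NodeE e1 e2) (Node a b) (s + t + 1)"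
  unfolding ev_def by (meson add_mono eval_evals.NodeE order_refl)

lemma ev_Left: "ev P env e a t \<Longrightarrow> ev P env (Left e) (left a) (t + 1)"
  unfolding ev_def by (metis add_mono eval_evals.Left order_refl)

lemma ev_Right: "ev P env e a t \<Longrightarrow> ev P env (Right e) (right a) (t + 1)"
  unfolding ev_def by (metis add_mono eval_evals.Right order_refl)

lemma ev_IfLeaf:
  "ev P env c v s \<Longrightarrow> v = Leaf \<Longrightarrow> ev P env e1 a t \<Longrightarrow> ev P env (IfLeaf c e1 e2) a (s + t + 1)"
  unfolding ev_def by (meson add_mono eval_evals.IfLeaf order_refl)

lemma ev_IfNode:
  "ev P env c v s \<Longrightarrow> v \<noteq> Leaf \<Longrightarrow> ev P env e2 a t \<Longrightarrow> ev P env (IfLeaf c e1 e2) a (s + t + 1)"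
  unfolding ev_def by (cases v) (simp, meson add_mono eval_evals.IfNode order_refl)

lemma ev_LetE:
  "ev P env e1 a s \<Longrightarrow> ev P (a # env) e2 b t \<Longrightarrow> ev P env (LetE e1 e2) b (s + t + 1)"
  unfolding ev_def by (meson add_mono eval_evals.LetE order_refl)

text \<open>The body comes first so that its known specification fixes \<open>as\<close> and the
  cost; the evaluated arguments are matched with \<open>as\<close> afterwards, by an
  equation.\<close>

lemma ev_Call:
  "ev P as (P ! g) b t \<Longrightarrow> g < length P \<Longrightarrow> evs P env es bs s \<Longrightarrow> bs = as \<Longrightarrow>
    ev P env (Call g es) b (s + t + 1)"
  unfolding ev_def evs_def by (meson add_mono eval_evals.Call order_refl)

lemma evs_Nil: "evs P env [] [] 0"
  unfolding evs_def by (auto intro: eval_evals.intros)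

lemma evs_Cons:
  "ev P env e a s \<Longrightarrow> evs P env es as t \<Longrightarrow> evs P env (e # es) (a # as) (s + t)"
  unfolding ev_def evs_def by (meson add_mono eval_evals.Cons)

lemmas ev_intros = ev_Var ev_LeafE ev_NodeE ev_Left ev_Right ev_LetE evs_Nil evs_Cons

definition computes :: "program \<Rightarrow> nat \<Rightarrow> ('a::enc \<Rightarrow> 'b::enc) \<Rightarrow> ('a \<Rightarrow> nat) \<Rightarrow> bool" where
  "computes P i f T \<longleftrightarrow> i < length P \<and> (\<forall>x. ev P [enc x] (P ! i) (enc (f x)) (T x))"

lemma computes_embed:
  assumes "computes P 0 f T" "length B = m"
  shows "computes (B @ map (shift m) P @ C) m f T"
proof -
  let ?Q = "B @ map (shift m) P @ C"
  have *: "?Q ! (i + m) = shift m (P ! i)" if "i < length P" for i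
    using that assms(2) by (simp add: nth_append)
  have len: "0 < length P" "length P + m \<le> length ?Q"
    using assms unfolding computes_def by auto
  have "ev ?Q [enc x] (shift m (P ! 0)) (enc (f x)) (T x)" for x
    using assms(1) eval_shift(1)[of P ?Q m, OF * len(2)] unfolding computes_def ev_def by blast
  moreover have "?Q ! m = shift m (P ! 0)"
    using *[of 0] len by simp
  moreover have "m < length ?Q" using len by linarith
  ultimately show ?thesis unfolding computes_def by simp
qed

lemma computes_embed2:
  assumes "computes P 0 f T" "length B + length A = m"
  shows "computes (B @ A @ map (shift m) P @ C) m f T"
  using computes_embed[of P f T "B @ A" m C] assms by simp

lemma ev_Call1:
  assumes "computes P g f T" "ev P env e a s" "a = enc x"
  shows "ev P env (Call g [e]) (enc (f x)) (s + T x + 1)"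
proof -
  have "ev P env (Call g [e]) (enc (f x)) ((s + 0) + T x + 1)"
    by (rule ev_Call[where as = "[enc x]"], use assms(1) in \<open>simp add: computes_def\<close>,
        use assms(1) in \<open>simp add: computes_def\<close>, (rule evs_Cons evs_Nil assms(2))+)
      (simp add: assms(3))
  then show ?thesis by simp
qed

lemma computes_comp:
  assumes "computes P 0 f T" "computes Q 0 g U"
  shows "\<exists>R. computes R 0 (\<lambda>x. f (g x)) (\<lambda>x. T (g x) + U x + 3)"
proof -
  let ?B = "[Call 1 [Call (1 + length P) [Var 0]]]"
  let ?R = "?B @ map (shift 1) P @ map (shift (1 + length P)) Q @ []"
  have f: "computes ?R 1 f T" by (rule computes_embed[OF assms(1)]) simp
  have g: "computes ?R (1 + length P) g U" by (rule computes_embed2[OF assms(2)]) simp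
  have "ev ?R [enc x] (?R ! 0) (enc (f (g x))) (T (g x) + U x + 3)" for x
  proof -
    have "ev ?R [enc x] (Call 1 [Call (1 + length P) [Var 0]]) (enc (f (g x)))
            (((1 + U x + 1)) + T (g x) + 1)"
      by (rule ev_Call1[OF f] ev_Call1[OF g] ev_Var refl | simp)+
    then show ?thesis by (auto elim!: ev_mono)
  qed
  then have "computes ?R 0 (\<lambda>x. f (g x)) (\<lambda>x. T (g x) + U x + 3)"
    unfolding computes_def by simp
  then show ?thesis by blast
qed

text \<open>
  The size of the result is bounded separately: trees are shared, so a program can build an
  exponentially large tree in linear time.
\<close>

definition polytime :: "('a::enc \<Rightarrow> 'b::enc) \<Rightarrow> bool" where
  "polytime f \<longleftrightarrow> (\<exists>P T. computes P 0 f T \<and> poly_bounded T) \<and> poly_bounded (\<lambda>x. esize (f x))"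

lemma polytimeD: "polytime f \<Longrightarrow> poly_bounded (\<lambda>x. esize (f x))"
  unfolding polytime_def by blast

lemma polytimeI:
  assumes "computes P 0 f T" "poly_bounded T" "poly_bounded (\<lambda>x. esize (f x))"
  shows "polytime f"
  using assms unfolding polytime_def by blast

lemma polytime_comp:
  assumes "polytime f" "polytime g"
  shows "polytime (\<lambda>x. f (g x))"
proof -
  obtain P T Q U where *: "computes P 0 f T" "poly_bounded T" "computes Q 0 g U" "poly_bounded U"
    using assms unfolding polytime_def by blast
  obtain R where R: "computes R 0 (\<lambda>x. f (g x)) (\<lambda>x. T (g x) + U x + 3)"
    using computes_comp[OF *(1,3)] by blast
  show ?thesis
    by (rule polytimeI[OF R])
      (intro poly_bounded_add poly_bounded_const poly_bounded_comp[OF *(2)] *(4)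
        polytimeD[OF assms(2)] poly_bounded_comp[OF polytimeD[OF assms(1)]])+
qed

lemma polytime_Pair:
  assumes "polytime f" "polytime g"
  shows "polytime (\<lambda>x. (f x, g x))"
proof -
  obtain P T Q U where *: "computes P 0 f T" "poly_bounded T" "computes Q 0 g U" "poly_bounded U"
    using assms unfolding polytime_def by blast
  let ?B = "[NodeE (Call 1 [Var 0]) (Call (1 + length P) [Var 0])]"
  let ?R = "?B @ map (shift 1) P @ map (shift (1 + length P)) Q @ []"
  have f: "computes ?R 1 f T" by (rule computes_embed[OF *(1)]) simp
  have g: "computes ?R (1 + length P) g U" by (rule computes_embed2[OF *(3)]) simp
  have "ev ?R [enc x] (?R ! 0) (enc (f x, g x)) (T x + U x + 5)" for x
  proof -
    have "ev ?R [enc x] (hd ?B) (Node (enc (f x)) (enc (g x)))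
            ((1 + T x + 1) + (1 + U x + 1) + 1)"
      unfolding list.sel by (rule ev_NodeE ev_Call1[OF f] ev_Call1[OF g] ev_Var refl | simp)+
    then show ?thesis by (auto elim!: ev_mono)
  qed
  then have R: "computes ?R 0 (\<lambda>x. (f x, g x)) (\<lambda>x. T x + U x + 5)"
    unfolding computes_def by simp
  have "poly_bounded (\<lambda>x. T x + U x + 5)"
    by (intro poly_bounded_add poly_bounded_const *(2,4))
  moreover have "poly_bounded (\<lambda>x. esize (f x, g x))"
    unfolding esize_simps
    by (intro poly_bounded_add poly_bounded_const polytimeD assms)
  ultimately show ?thesis by (rule polytimeI[OF R])
qed

lemma polytime_expr:
  assumes "\<And>x. ev [e] [enc x] e (enc (f x)) T" "poly_bounded (\<lambda>x. esize (f x))"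
  shows "polytime f"
  by (rule polytimeI[of "[e]" f "\<lambda>x. T"])
    (use assms in \<open>auto simp: computes_def intro: poly_bounded_const\<close>)

lemma polytime_id: "polytime (\<lambda>x. x)"
  by (rule polytime_expr[of "Var 0"], rule ev_cong, rule ev_Var)
    (auto intro: poly_bounded_esize)

lemma ev_const: "\<exists>e T. \<forall>P env. ev P env e t T"
proof (induction t)
  case Leaf
  show ?case using ev_LeafE by blast
next
  case (Node a b)
  then show ?case using ev_NodeE by blast
qed

lemma polytime_const: "polytime (\<lambda>x. c)"
proof -
  obtain e T where "\<And>P env. ev P env e (enc c) T"
    using ev_const by blast
  then show ?thesis
    by (intro polytime_expr[of e _ T] poly_bounded_const) auto
qed

lemma polytime_fst: "polytime (fst :: 'a::enc \<times> 'b::enc \<Rightarrow> 'a)"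
proof (rule polytime_expr[of "Left (Var 0)" _ "1 + 1"])
  show "ev [Left (Var 0)] [enc x] (Left (Var 0)) (enc (fst x)) (1 + 1)" for x :: "'a \<times> 'b"
    by (rule ev_cong, (rule ev_intros)+) (auto simp: enc_prod_def)
  show "poly_bounded (\<lambda>x :: 'a \<times> 'b. esize (fst x))"
    by (rule poly_bounded_mono[OF poly_bounded_esize]) auto
qed

lemma polytime_snd: "polytime (snd :: 'a::enc \<times> 'b::enc \<Rightarrow> 'b)"
proof (rule polytime_expr[of "Right (Var 0)" _ "1 + 1"])
  show "ev [Right (Var 0)] [enc x] (Right (Var 0)) (enc (snd x)) (1 + 1)" for x :: "'a \<times> 'b"
    by (rule ev_cong, (rule ev_intros)+) (auto simp: enc_prod_def)
  show "poly_bounded (\<lambda>x :: 'a \<times> 'b. esize (snd x))"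
    by (rule poly_bounded_mono[OF poly_bounded_esize]) auto
qed

lemma poly_bounded_power: "poly_bounded T \<Longrightarrow> poly_bounded (\<lambda>x. T x ^ c)"
proof (induction c)
  case 0
  show ?case unfolding power_0 by (rule poly_bounded_const)
next
  case (Suc c)
  then show ?case unfolding power_Suc by (intro poly_bounded_mult)
qed

lemmas poly_bounded_intros = poly_bounded_const poly_bounded_add poly_bounded_mult
  poly_bounded_power poly_bounded_esize

text \<open>Both branches take polynomial time, so they are computed in advance and only the
  selection from a triple is programmed.\<close>

lemma polytime_If:
  fixes f g :: "'a::enc \<Rightarrow> 'b::enc"
  assumes "polytime b" "polytime f" "polytime g"
  shows "polytime (\<lambda>x. if b x then f x else g x)"
proof -
  let ?f = "\<lambda>p :: bool \<times> 'b \<times> 'b. if fst p then fst (snd p) else snd (snd p)"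
  let ?e = "IfLeaf (Left (Var 0)) (Right (Right (Var 0))) (Left (Right (Var 0)))"
  have "polytime ?f"
  proof (rule polytime_expr[of ?e])
    fix x :: "bool \<times> 'b \<times> 'b"
    obtain b y z where x: "x = (b, y, z)" by (cases x)
    show "ev [?e] [enc x] ?e (enc (?f x)) 6"
    proof (cases b)
      case True
      show ?thesis unfolding x
        by (rule ev_cong, rule ev_IfNode) (rule ev_intros | simp add: True)+
    next
      case False
      show ?thesis unfolding x
        by (rule ev_cong, rule ev_IfLeaf) (rule ev_intros | simp add: False)+
    qed
  next
    show "poly_bounded (\<lambda>x. esize (?f x))"
      by (rule poly_bounded_mono[OF poly_bounded_esize]) auto
  qed
  from polytime_comp[OF this polytime_Pair[OF assms(1) polytime_Pair[OF assms(2,3)]]]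
  show ?thesis by (simp only: fst_conv snd_conv)
qed

text \<open>As \<open>enc\<close> is injective, equality is decided by a simultaneous recursion
  through the two encodings. It visits each node of the first tree at most once, hence the linear
  bound.\<close>

lemma polytime_eq:
  fixes f g :: "'a::enc \<Rightarrow> 'b::enc"
  assumes "polytime f" "polytime g"
  shows "polytime (\<lambda>x. f x = g x)"
proof -
  let ?r = "\<lambda>e. Call 1 [e (Var 0), e (Var 1)]"
  let ?b = "IfLeaf (Var 0) (IfLeaf (Var 1) (NodeE LeafE LeafE) LeafE)
    (IfLeaf (Var 1) LeafE (IfLeaf (?r Left) LeafE (?r Right)))"
  let ?P = "[Call 1 [Left (Var 0), Right (Var 0)], ?b]"
  let ?f = "\<lambda>p :: 'b \<times> 'b. fst p = snd p"
  have P1: "?P ! 1 = ?b" by simp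
  have eq: "ev ?P [s, t] (?P ! 1) (enc (s = t)) (size s * 30 + 7)" for s t
  proof (induction s arbitrary: t)
    case Leaf
    show ?case
    proof (cases "t = Leaf")
      case True
      show ?thesis unfolding True P1
        by (rule ev_cong, rule ev_IfLeaf, rule ev_Var, simp, simp, rule ev_IfLeaf)
          (rule ev_intros | simp)+
    next
      case False
      show ?thesis unfolding P1
        by (rule ev_cong, rule ev_IfLeaf, rule ev_Var, simp, simp, rule ev_IfNode)
          (rule ev_intros | simp add: False False[symmetric])+
    qed
  next
    case (Node s1 s2)
    show ?case
    proof (cases t)
      case Leaf
      show ?thesis unfolding Leaf P1
        by (rule ev_cong, rule ev_IfNode, rule ev_Var, simp, simp, rule ev_IfLeaf)
          (rule ev_intros | simp)+
    next
      case t: (Node t1 t2)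
      have l: "ev ?P [Node s1 s2, t] (?r Left) (enc (s1 = t1)) (size s1 * 30 + 12)"
        by (rule ev_cong, rule ev_Call, rule Node.IH(1)) (rule ev_intros | simp add: t)+
      have r: "ev ?P [Node s1 s2, t] (?r Right) (enc (s2 = t2)) (size s2 * 30 + 12)"
        by (rule ev_cong, rule ev_Call, rule Node.IH(2)) (rule ev_intros | simp add: t)+
      have *: "ev ?P [Node s1 s2, t] (IfLeaf (?r Left) LeafE (?r Right)) (enc (Node s1 s2 = t))
          ((size s1 + size s2) * 30 + 25)"
      proof (cases "s1 = t1")
        case True
        show ?thesis
          by (rule ev_cong, rule ev_IfNode, rule l) (rule ev_intros r | simp add: t True)+
      next
        case False
        show ?thesis
          by (rule ev_cong, rule ev_IfLeaf, rule l) (rule ev_intros r | simp add: t False)+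
      qed
      show ?thesis unfolding P1
        by (rule ev_cong, rule ev_IfNode, rule ev_Var, simp, simp, rule ev_IfNode, rule ev_Var,
            simp, simp add: t, rule *) (simp_all add: t)
    qed
  qed
  have "computes ?P 0 ?f (\<lambda>p. esize p * 30 + 12)"
    unfolding computes_def
  proof (intro conjI allI)
    fix p :: "'b \<times> 'b"
    obtain y z where p: "p = (y, z)" by (cases p)
    have "ev ?P [enc p] (Call 1 [Left (Var 0), Right (Var 0)]) (enc (?f p)) (esize p * 30 + 12)"
      by (rule ev_cong, rule ev_Call, rule eq[of "enc y" "enc z"])
        (rule ev_intros | simp add: p esize_def)+
    then show "ev ?P [enc p] (?P ! 0) (enc (?f p)) (esize p * 30 + 12)" by simp
  qed simp
  then have "polytime ?f"
    by (rule polytimeI) (intro poly_bounded_intros poly_bounded_mono[OF poly_bounded_const, of _ 1] esize_bool)+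
  from polytime_comp[OF this polytime_Pair[OF assms]] show ?thesis by simp
qed

text \<open>The bound \<open>B\<close> on the states after every prefix is essential: a
  polynomial-time step may square the size of its state, and iterating such a step leaves polynomial
  time.\<close>

lemma polytime_fold:
  fixes h :: "'a::enc \<Rightarrow> 'e::enc \<Rightarrow> 's::enc \<Rightarrow> 's"
  assumes h: "polytime (\<lambda>p. h (fst p) (fst (snd p)) (snd (snd p)))"
    and xs: "polytime xs" and s0: "polytime s0" and B: "poly_bounded B"
    and bound: "\<And>x ys zs. xs x = ys @ zs \<Longrightarrow> esize (fold (h x) ys (s0 x)) \<le> B x"
  shows "polytime (\<lambda>x. fold (h x) (xs x) (s0 x))"
proof -
  let ?h = "\<lambda>p. h (fst p) (fst (snd p)) (snd (snd p))" and ?q = "\<lambda>x. (x, xs x, s0 x)"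
  have "polytime ?q" by (intro polytime_Pair polytime_id xs s0)
  then obtain P c H Q U where P: "computes P 0 ?h H" and H: "\<And>x. H x \<le> (esize x + 2) ^ c"
    and Q: "computes Q 0 ?q U" and U: "poly_bounded U"
    using h unfolding polytime_def poly_bounded_def by meson
  let ?j = "2 + length P"
  \<comment> \<open>\<open>?start\<close> computes the triple of input, list and initial state once;
    the environment of \<open>?loop\<close> is the input, the rest of the list and the current
    state.\<close>
  let ?start = "LetE (Call ?j [Var 0]) (Call 1 [Left (Var 0), Left (Right (Var 0)), Right (Right (Var 0))])"
  let ?loop = "IfLeaf (Var 1) (Var 2)
    (Call 1 [Var 0, Right (Var 1), Call 2 [NodeE (Var 0) (NodeE (Left (Var 1)) (Var 2))]])"
  let ?R = "[?start, ?loop] @ map (shift 2) P @ map (shift ?j) Q @ []"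
  have P': "computes ?R 2 ?h H" by (rule computes_embed[OF P]) simp
  have Q': "computes ?R ?j ?q U" by (rule computes_embed2[OF Q]) simp
  have R1: "?R ! 1 = ?loop" by simp
  have loop: "ev ?R [enc x, enc l, enc s] (?R ! 1) (enc (fold (h x) l s)) (length l * (C + 20) + 3)"
    if "\<And>ys e zs. l = ys @ e # zs \<Longrightarrow> H (x, e, fold (h x) ys s) \<le> C" for x l s C
    using that
  proof (induction l arbitrary: s)
    case Nil
    show ?case unfolding R1
      by (rule ev_cong, rule ev_IfLeaf) (rule ev_intros | simp)+
  next
    case (Cons e l)
    let ?env = "[enc x, enc (e # l), enc s]"
    have IH: "ev ?R [enc x, enc l, enc (h x e s)] (?R ! 1) (enc (fold (h x) l (h x e s)))
        (length l * (C + 20) + 3)"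
      by (rule Cons.IH) (use Cons.prems[of "e # ys" for ys] in simp)
    have *: "ev ?R ?env (Call 2 [NodeE (Var 0) (NodeE (Left (Var 1)) (Var 2))]) (enc (h x e s)) (C + 7)"
      by (rule ev_cong, rule ev_Call1[OF P', where x = "(x, e, s)"])
        (rule ev_intros | use Cons.prems[of "[]" e l] in simp)+
    have "ev ?R ?env (Call 1 [Var 0, Right (Var 1), Call 2 [NodeE (Var 0) (NodeE (Left (Var 1)) (Var 2))]])
       (enc (fold (h x) (e # l) s)) (length l * (C + 20) + C + 15)"
      by (rule ev_cong, rule ev_Call, rule IH) (rule ev_intros * | simp)+
    then show ?case unfolding R1
      by - (rule ev_cong, rule ev_IfNode, rule ev_Var, simp, simp, assumption, simp_all)
  qed
  \<comment> \<open>One step works on \<open>(x, e, s)\<close>, of size at most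
    \<open>esize x + esize (xs x) + B x + 2\<close>; the base of \<open>poly_bounded\<close> adds
    another 2.\<close>
  let ?C = "\<lambda>x. (esize x + esize (xs x) + B x + 4) ^ c"
  let ?T = "\<lambda>x. U x + (esize (xs x) * (?C x + 20) + 3) + 13"
  have "computes ?R 0 (\<lambda>x. fold (h x) (xs x) (s0 x)) ?T"
    unfolding computes_def
  proof (intro conjI allI)
    fix x
    have "H (x, e, fold (h x) ys (s0 x)) \<le> ?C x" if "xs x = ys @ e # zs" for ys e zs
    proof -
      have "H (x, e, fold (h x) ys (s0 x)) \<le> (esize (x, e, fold (h x) ys (s0 x)) + 2) ^ c" by (rule H)
      also have "\<dots> \<le> ?C x"
        using bound[OF that] that by (intro power_mono) auto
      finally show ?thesis .
    qed
    from loop[OF this]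
    have l: "ev ?R [enc x, enc (xs x), enc (s0 x)] (?R ! 1) (enc (fold (h x) (xs x) (s0 x)))
        (esize (xs x) * (?C x + 20) + 3)"
      by (rule ev_mono) (use length_le_esize[of "xs x"] in auto)
    have q: "ev ?R [enc x] (Call ?j [Var 0]) (enc (?q x)) (U x + 2)"
      by (rule ev_cong, rule ev_Call1[OF Q', where x = x]) (rule ev_intros | simp)+
    have "ev ?R [enc x] ?start (enc (fold (h x) (xs x) (s0 x))) (?T x)"
      by (rule ev_cong, rule ev_LetE, rule q, rule ev_Call, rule l)
        (rule ev_intros | simp)+
    then show "ev ?R [enc x] (?R ! 0) (enc (fold (h x) (xs x) (s0 x))) (?T x)" by simp
  qed simp
  moreover have "poly_bounded ?T"
    by (intro poly_bounded_intros U B polytimeD[OF xs])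
  moreover have "poly_bounded (\<lambda>x. esize (fold (h x) (xs x) (s0 x)))"
    by (rule poly_bounded_mono[OF B]) (rule bound[of _ _ "[]"], simp)
  ultimately show ?thesis by (rule polytimeI)
qed

text \<open>\<open>polytime\<close> sees only the encoded result, so one program serves functions of
  different types: a nonempty list is encoded like a pair, and \<open>Suc n\<close> like the pair of
  \<open>()\<close> and \<open>n\<close>.\<close>

lemma polytime_recode:
  fixes f :: "'a::enc \<Rightarrow> 'b::enc" and g :: "'a \<Rightarrow> 'c::enc"
  assumes "polytime f" "\<And>x. enc (f x) = enc (g x)"
  shows "polytime g"
  using assms unfolding polytime_def computes_def esize_def by simp

lemma polytime_cong:
  assumes "polytime f" "\<And>x. f x = g x"
  shows "polytime g"
  using assms(1) by (rule polytime_recode) (simp add: assms(2))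

section \<open>Closure properties of polynomial time\<close>

named_theorems polytime_intros

lemmas [polytime_intros] = polytime_const polytime_id polytime_Pair polytime_If polytime_eq
  polytime_comp[OF polytime_fst] polytime_comp[OF polytime_snd]

lemma polytime_Cons [polytime_intros]:
  assumes "polytime f" "polytime g"
  shows "polytime (\<lambda>x. f x # g x)"
  using polytime_Pair[OF assms] by (rule polytime_recode) simp

lemma polytime_Suc [polytime_intros]:
  assumes "polytime f"
  shows "polytime (\<lambda>x. Suc (f x))"
  using polytime_Pair[OF polytime_const[of "()"] assms] by (rule polytime_recode) simp

lemma polytime_tl [polytime_intros]:
  fixes f :: "'a::enc \<Rightarrow> 'b::enc list"
  assumes "polytime f"
  shows "polytime (\<lambda>x. tl (f x))"
proof -
  have "polytime (tl :: 'b list \<Rightarrow> 'b list)"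
  proof (rule polytime_expr[of "Right (Var 0)" _ 2])
    show "ev [Right (Var 0)] [enc x] (Right (Var 0)) (enc (tl x)) 2" for x :: "'b list"
      by (rule ev_cong, (rule ev_intros)+) (cases x; simp)+
    show "poly_bounded (\<lambda>x :: 'b list. esize (tl x))"
    proof (rule poly_bounded_mono[OF poly_bounded_esize])
      show "esize (tl x) \<le> esize x" for x :: "'b list" by (cases x) auto
    qed
  qed
  from polytime_comp[OF this assms] show ?thesis .
qed

lemma polytime_conj [polytime_intros]:
  assumes "polytime P" "polytime Q"
  shows "polytime (\<lambda>x. P x \<and> Q x)"
  using polytime_If[OF assms polytime_const[of False]] by (rule polytime_cong) simp

lemma polytime_disj [polytime_intros]:
  assumes "polytime P" "polytime Q"
  shows "polytime (\<lambda>x. P x \<or> Q x)"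
  using polytime_If[OF assms(1) polytime_const[of True] assms(2)] by (rule polytime_cong) simp

lemma polytime_not [polytime_intros]:
  assumes "polytime P"
  shows "polytime (\<lambda>x. \<not> P x)"
  using polytime_If[OF assms polytime_const[of False] polytime_const[of True]]
  by (rule polytime_cong) simp

lemma polytime_imp [polytime_intros]:
  assumes "polytime P" "polytime Q"
  shows "polytime (\<lambda>x. P x \<longrightarrow> Q x)"
  using polytime_If[OF assms polytime_const[of True]] by (rule polytime_cong) simp

lemma polytime_bex [polytime_intros]:
  assumes "polytime (\<lambda>p. P (fst p) (snd p))" "polytime xs"
  shows "polytime (\<lambda>x. \<exists>e\<in>set (xs x). P x e)"
proof -
  have *: "fold (\<lambda>e s. s \<or> P x e) l s \<longleftrightarrow> s \<or> (\<exists>e\<in>set l. P x e)" for x l s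
    by (induction l arbitrary: s) auto
  \<comment> \<open>The step function of \<open>polytime_fold\<close> receives
    \<open>(x, e, s)\<close>, whereas \<open>P\<close> is given on pairs \<open>(x, e)\<close>; the
    composition with a projection bridges this, here and below.\<close>
  have "polytime (\<lambda>x. fold (\<lambda>e s. s \<or> P x e) (xs x) False)"
    by (rule polytime_fold[where B = "\<lambda>x. 1"])
      (intro polytime_intros polytime_comp[OF assms(1), of "\<lambda>p. (fst p, fst (snd p))", simplified]
        assms(2) poly_bounded_intros esize_bool)+
  then show ?thesis by (rule polytime_cong) (simp add: *)
qed

lemma polytime_ball [polytime_intros]:
  assumes "polytime (\<lambda>p. P (fst p) (snd p))" "polytime xs"
  shows "polytime (\<lambda>x. \<forall>e\<in>set (xs x). P x e)"
proof -
  have "polytime (\<lambda>x. \<not> (\<exists>e\<in>set (xs x). \<not> P x e))"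
    by (intro polytime_intros assms)
  then show ?thesis by (rule polytime_cong) simp
qed

lemma polytime_member [polytime_intros]:
  assumes "polytime y" "polytime xs"
  shows "polytime (\<lambda>x. y x \<in> set (xs x))"
proof -
  have "polytime (\<lambda>x. \<exists>e\<in>set (xs x). e = y x)"
    by (intro polytime_intros polytime_comp[OF assms(1)] assms)
  then show ?thesis by (rule polytime_cong) auto
qed

lemma esize_rev [simp]: "esize (rev xs) = esize xs"
  by (induction xs) auto

lemma fold_Cons: "fold (#) xs ys = rev xs @ ys"
  by (induction xs arbitrary: ys) auto

lemma polytime_rev [polytime_intros]:
  assumes "polytime xs"
  shows "polytime (\<lambda>x. rev (xs x))"
proof -
  have "polytime (\<lambda>x. fold (#) (xs x) [])"
    by (rule polytime_fold[where B = "\<lambda>x. esize (xs x)"])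
      ((intro polytime_intros assms polytimeD)+, simp add: fold_Cons)
  then show ?thesis by (rule polytime_cong) (simp add: fold_Cons)
qed

lemma polytime_append [polytime_intros]:
  assumes "polytime xs" "polytime ys"
  shows "polytime (\<lambda>x. xs x @ ys x)"
proof -
  have "esize (rev us @ ys x) \<le> esize (xs x) + esize (ys x)" if "rev (xs x) = us @ vs" for x us vs
    using arg_cong[OF that, of esize] by simp
  then have "polytime (\<lambda>x. fold (#) (rev (xs x)) (ys x))"
    by (intro polytime_fold[where B = "\<lambda>x. esize (xs x) + esize (ys x)"] polytime_intros assms
        polytimeD poly_bounded_add) (auto simp: fold_Cons)
  then show ?thesis by (rule polytime_cong) (simp add: fold_Cons)
qed

lemma esize_filter: "esize (filter P xs) \<le> esize xs"
  by (induction xs) auto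

lemma polytime_filter [polytime_intros]:
  assumes "polytime (\<lambda>p. P (fst p) (snd p))" "polytime xs"
  shows "polytime (\<lambda>x. filter (P x) (xs x))"
proof -
  have *: "fold (\<lambda>e s. if P x e then e # s else s) l s = rev (filter (P x) l) @ s" for x l s
    by (induction l arbitrary: s) auto
  have "esize (filter (P x) us) \<le> esize (xs x)" if "xs x = us @ vs" for x us vs
    using esize_filter[of "P x" us] that by simp
  then have "polytime (\<lambda>x. fold (\<lambda>e s. if P x e then e # s else s) (xs x) [])"
    by (intro polytime_fold[where B = "\<lambda>x. esize (xs x)"] polytime_intros assms polytimeD
        polytime_comp[OF assms(1), of "\<lambda>p. (fst p, fst (snd p))", simplified]) (simp add: *)
  from polytime_rev[OF this] show ?thesis by (rule polytime_cong) (simp add: *)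
qed

lemma esize_map:
  assumes "\<And>e. e \<in> set xs \<Longrightarrow> esize (f e) \<le> B"
  shows "esize (map f xs) \<le> length xs * (B + 1)"
  using assms
proof (induction xs)
  case (Cons e xs)
  then have "esize (f e) \<le> B" "esize (map f xs) \<le> length xs * (B + 1)" by auto
  then show ?case by simp
qed simp

lemma polytime_map [polytime_intros]:
  assumes "polytime (\<lambda>p. f (fst p) (snd p))" "polytime xs"
  shows "polytime (\<lambda>x. map (f x) (xs x))"
proof -
  have *: "fold (\<lambda>e s. f x e # s) l s = rev (map (f x) l) @ s" for x l s
    by (induction l arbitrary: s) auto
  obtain c where c: "esize (f x e) \<le> (esize (x, e) + 2) ^ c" for x e
    using polytimeD[OF assms(1)] unfolding poly_bounded_def by fastforce
  let ?B = "\<lambda>x. esize (xs x) * ((esize x + esize (xs x) + 3) ^ c + 1)"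
  have "esize (map (f x) us) \<le> ?B x" if "xs x = us @ vs" for x us vs
  proof -
    have "esize (map (f x) us) \<le> length us * ((esize x + esize (xs x) + 3) ^ c + 1)"
    proof (rule esize_map)
      fix e
      assume "e \<in> set us"
      then have "esize e \<le> esize (xs x)" using esize_elem[of e us] that by simp
      then show "esize (f x e) \<le> (esize x + esize (xs x) + 3) ^ c"
        by (intro order_trans[OF c] power_mono) auto
    qed
    also have "\<dots> \<le> ?B x"
      using length_le_esize[of us] that by (intro mult_right_mono) auto
    finally show ?thesis .
  qed
  then have "polytime (\<lambda>x. fold (\<lambda>e s. f x e # s) (xs x) [])"
    by (intro polytime_fold[where B = ?B] polytime_intros assms polytimeD poly_bounded_intros
        polytime_comp[OF assms(1), of "\<lambda>p. (fst p, fst (snd p))", simplified]) (simp add: *)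
  from polytime_rev[OF this] show ?thesis by (rule polytime_cong) (simp add: *)
qed

lemma esize_concat: "esize (concat xss) \<le> esize xss"
  by (induction xss) auto

lemma polytime_concat [polytime_intros]:
  assumes "polytime xss"
  shows "polytime (\<lambda>x. concat (xss x))"
proof -
  have *: "fold (\<lambda>e s. s @ e) l s = s @ concat l" for l and s :: "'b list"
    by (induction l arbitrary: s) auto
  have "esize (concat us) \<le> esize (xss x)" if "xss x = us @ vs" for x us vs
    using esize_concat[of us] that by simp
  then have "polytime (\<lambda>x. fold (\<lambda>e s. s @ e) (xss x) [])"
    by (intro polytime_fold[where B = "\<lambda>x. esize (xss x)"] polytime_intros assms polytimeD)
      (simp add: *)
  then show ?thesis by (rule polytime_cong) (simp add: *)
qed

lemma polytime_length [polytime_intros]: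
  assumes "polytime xs"
  shows "polytime (\<lambda>x. length (xs x))"
proof -
  have *: "fold (\<lambda>_. Suc) l s = length l + s" for l :: "'b list" and s
    by (induction l arbitrary: s) auto
  have "length us \<le> esize (xs x)" if "xs x = us @ vs" for x us vs
    using length_le_esize[of us] that by simp
  then have "polytime (\<lambda>x. fold (\<lambda>_. Suc) (xs x) 0)"
    by (intro polytime_fold[where B = "\<lambda>x. esize (xs x)"] polytime_intros assms polytimeD)
      (simp add: *)
  then show ?thesis by (rule polytime_cong) (simp add: *)
qed

text \<open>A unary number and the list of that many \<open>()\<close> have the same encoding, so
  arithmetic becomes list processing.\<close>

lemma polytime_replicate [polytime_intros]:
  assumes "polytime n" "polytime y"
  shows "polytime (\<lambda>x. replicate (n x) (y x))"
proof -
  have "enc n = enc (replicate n ())" for n :: nat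
    by (induction n) auto
  then have "polytime (\<lambda>x. replicate (n x) ())"
    by (intro polytime_recode[OF assms(1)])
  then have "polytime (\<lambda>x. map (\<lambda>_. y x) (replicate (n x) ()))"
    by (intro polytime_intros polytime_comp[OF assms(2)])
  then show ?thesis by (rule polytime_cong) simp
qed

lemma polytime_add [polytime_intros]:
  assumes "polytime m" "polytime n"
  shows "polytime (\<lambda>x. m x + n x :: nat)"
  by (rule polytime_cong[of "\<lambda>x. length (replicate (m x) () @ replicate (n x) ())"])
    (intro polytime_intros assms, simp)

lemma length_concat_replicate: "length (concat (replicate m xs)) = m * length xs"
  by (induction m) auto

lemma polytime_mult [polytime_intros]:
  assumes "polytime m" "polytime n"
  shows "polytime (\<lambda>x. m x * n x :: nat)"
  by (rule polytime_cong[of "\<lambda>x. length (concat (replicate (m x) (replicate (n x) ())))"])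
    (intro polytime_intros assms, simp add: length_concat_replicate)

lemma polytime_power [polytime_intros]:
  assumes "polytime n"
  shows "polytime (\<lambda>x. n x ^ c :: nat)"
  by (induction c) (simp_all only: power_0 power_Suc, (intro polytime_intros assms | simp)+)

lemma esize_drop: "esize (drop m xs) \<le> esize xs"
proof -
  have "esize (take m xs @ drop m xs) = esize (take m xs) + esize (drop m xs)"
    by (rule esize_append)
  then show ?thesis by simp
qed

lemma polytime_drop [polytime_intros]:
  assumes "polytime m" "polytime xs"
  shows "polytime (\<lambda>x. drop (m x) (xs x))"
proof -
  have *: "fold (\<lambda>_. tl) l s = drop (length l) s" for l :: "unit list" and s :: "'b list"
    by (induction l arbitrary: s) (auto simp: drop_Suc)
  then have "polytime (\<lambda>x. fold (\<lambda>_. tl) (replicate (m x) ()) (xs x))"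
    by (intro polytime_fold[where B = "\<lambda>x. esize (xs x)"] polytime_intros assms polytimeD)
      (simp only: * esize_drop)
  then show ?thesis by (rule polytime_cong) (simp only: * length_replicate)
qed

lemma polytime_less [polytime_intros]:
  assumes "polytime m" "polytime n"
  shows "polytime (\<lambda>x. m x < (n x :: nat))"
  by (rule polytime_cong[of "\<lambda>x. drop (m x) (replicate (n x) ()) \<noteq> []"])
    (intro polytime_intros assms, simp add: not_le)

lemma polytime_le [polytime_intros]:
  assumes "polytime m" "polytime n"
  shows "polytime (\<lambda>x. m x \<le> (n x :: nat))"
  by (rule polytime_cong[of "\<lambda>x. m x < Suc (n x)"]) (intro polytime_intros assms, simp add: less_Suc_eq_le)

lemma polytime_take [polytime_intros]:
  assumes "polytime m" "polytime xs"
  shows "polytime (\<lambda>x. take (m x) (xs x))"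
proof -
  have *: "fold (\<lambda>e s. if length s < m then s @ [e] else s) l s = s @ take (m - length s) l"
    for m l and s :: "'b list"
    by (induction l arbitrary: s) (auto simp: take_Cons' )
  have "esize (take m us) \<le> esize (xs x)" if "xs x = us @ vs" for m x us vs
    using esize_append[of "take m us" "drop m us"] that by simp
  then have "polytime (\<lambda>x. fold (\<lambda>e s. if length s < m x then s @ [e] else s) (xs x) [])"
    by (intro polytime_fold[where B = "\<lambda>x. esize (xs x)"] polytime_intros assms polytimeD
        polytime_comp[OF assms(1)]) (simp add: *)
  then show ?thesis by (rule polytime_cong) (simp add: *)
qed

text \<open>The state \<open>[0..<m]\<close> supplies its next element as its own length.\<close>

lemma polytime_upt [polytime_intros]:
  assumes "polytime n"
  shows "polytime (\<lambda>x. [0..<n x])"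
proof -
  have *: "fold (\<lambda>_ s. s @ [length s]) l [0..<m] = [0..<m + length l]" for l :: "unit list" and m
    by (induction l arbitrary: m) (auto simp del: upt_Suc simp flip: upt_Suc_append)
  have "esize [0..<m] \<le> m * m" for m
    by (induction m) auto
  then have "esize [0..<length us] \<le> n x * n x" if "replicate (n x) () = us @ vs" for x us vs
    using arg_cong[OF that, of length] by (intro order_trans[OF \<open>esize [0..<length us] \<le> _\<close>] mult_mono) auto
  then have "polytime (\<lambda>x. fold (\<lambda>_ s. s @ [length s]) (replicate (n x) ()) [])"
    by (intro polytime_fold[where B = "\<lambda>x. n x * n x"] polytime_intros assms poly_bounded_intros
        polytimeD[OF assms, simplified]) (simp add: *[of _ 0, simplified] del: fold_replicate)
  then show ?thesis by (rule polytime_cong) (simp add: *[of _ 0, simplified] del: fold_replicate)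
qed

text \<open>A unary \<open>2 ^ n\<close> is too long for \<open>polytime\<close>, so this program is
  written by hand: the previous power is added to itself. One round adds at most
  \<open>10 * 2 ^ n + 12\<close> to the cost, which the doubling of \<open>25 * 2 ^ n\<close>
  covers.\<close>

lemma computes_exp2: "\<exists>P. computes P 0 (\<lambda>n. 2 ^ n :: nat) (\<lambda>n. 25 * 2 ^ n)"
proof -
  let ?exp = "IfLeaf (Var 0) (NodeE LeafE LeafE)
    (LetE (Call 0 [Right (Var 0)]) (Call 1 [Var 0, Var 0]))"
  let ?add = "IfLeaf (Var 0) (Var 1) (NodeE LeafE (Call 1 [Right (Var 0), Var 1]))"
  let ?P = "[?exp, ?add]"
  have P: "?P ! 0 = ?exp" "?P ! 1 = ?add" by simp_all
  have add: "ev ?P [enc m, enc n] (?P ! 1) (enc (m + n)) (10 * m + 3)" for m n :: nat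
  proof (induction m)
    case 0
    show ?case unfolding P by (rule ev_cong, rule ev_IfLeaf) (rule ev_intros | simp)+
  next
    case (Suc m)
    have *: "ev ?P [enc (Suc m), enc n] (Call 1 [Right (Var 0), Var 1]) (enc (m + n)) (10 * m + 7)"
      by (rule ev_cong, rule ev_Call, rule Suc.IH) (rule ev_intros | simp)+
    show ?case unfolding P(2)
      by (rule ev_cong, rule ev_IfNode) (rule ev_intros * | simp)+
  qed
  have exp: "ev ?P [enc n] (?P ! 0) (enc (2 ^ n :: nat)) (25 * 2 ^ n)" for n :: nat
  proof (induction n)
    case 0
    show ?case unfolding P by (rule ev_cong, rule ev_IfLeaf) (rule ev_intros | simp)+
  next
    case (Suc n)
    have 1: "ev ?P [enc (Suc n)] (Call 0 [Right (Var 0)]) (enc (2 ^ n :: nat)) (25 * 2 ^ n + 3)"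
      by (rule ev_cong, rule ev_Call, rule Suc.IH) (rule ev_intros | simp)+
    have 2: "ev ?P [enc (2 ^ n :: nat), enc (Suc n)] (Call 1 [Var 0, Var 0]) (enc (2 ^ Suc n :: nat))
       (10 * 2 ^ n + 6)"
      by (rule ev_cong, rule ev_Call, rule add) (rule ev_intros | simp)+
    have "(1::nat) \<le> 2 ^ n" by simp
    then have "1 + ((25 * 2 ^ n + 3) + (10 * 2 ^ n + 6) + 1) + 1 \<le> 25 * (2::nat) ^ Suc n"
      unfolding power_Suc by linarith
    then show ?case unfolding P(1)
      by - (rule ev_cong, rule ev_IfNode, rule ev_Var, simp, simp, rule ev_LetE[OF 1 2], simp_all only:)
  qed
  then have "computes ?P 0 (\<lambda>n. 2 ^ n :: nat) (\<lambda>n. 25 * 2 ^ n)"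
    unfolding computes_def by simp
  then show ?thesis by blast
qed

section \<open>From polynomial time to fixed-parameter tractability\<close>

lemma computes_imp_computable:
  assumes "computes P 0 f T"
  shows "computable f"
  unfolding computable_def runs_def
proof (intro exI[of _ P] allI)
  fix n
  show "\<exists>t. P \<noteq> [] \<and> eval P [nat_tree n] (P ! 0) (nat_tree (f n)) t"
    using assms unfolding computes_def ev_def enc_nat_def by fastforce
qed

lemma esize_bools: "esize (x :: bool list) \<le> 2 * length x"
proof (induction x)
  case (Cons b x)
  then show ?case using esize_bool[of b] by simp
qed simp

text \<open>
  The additional unary input pays for the exponential part of an algorithm, which leaves only
  polynomial-time computations to be analysed.
\<close>

lemma fixed_parameter_tractableI:
  fixes A :: "bool list \<times> nat \<times> nat \<Rightarrow> bool"
  assumes A: "polytime A" and g: "polytime g" "\<And>k. k \<le> g k"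
    and L: "\<And>x k. A (x, k, 2 ^ 2 ^ g k) \<longleftrightarrow> (x, k) \<in> L"
  shows "fixed_parameter_tractable L"
proof -
  obtain P T c where P: "computes P 0 A T" and T: "\<And>y. T y \<le> (esize y + 2) ^ c"
    using A unfolding polytime_def poly_bounded_def by blast
  obtain G U d where G: "computes G 0 g U" and U: "\<And>k. U k \<le> (k + 2) ^ d"
    using g(1) unfolding polytime_def poly_bounded_def esize_nat by blast
  obtain E where E: "computes E 0 (\<lambda>n. 2 ^ n :: nat) (\<lambda>n. 25 * 2 ^ n)"
    using computes_exp2 by blast
  let ?M = "\<lambda>k. 2 ^ 2 ^ g k :: nat"
  \<comment> \<open>At \<open>m = ?M k\<close> the four summands pay for the run of \<open>A\<close>
    (after splitting off the instance size), the two exponentiations, the computation of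
    \<open>g\<close> and the calls.\<close>
  let ?F = "\<lambda>m. (m + 6) ^ c + 50 * m + (m + 6) ^ d + 20 :: nat"
  have "polytime ?F" by (intro polytime_intros)
  then obtain F V where F: "computes F 0 ?F V"
    unfolding polytime_def by blast
  \<comment> \<open>The bound is doubly exponential; its computability follows by composing the
    polynomial \<open>?F\<close> with two exponentiations and with \<open>g\<close>.\<close>
  obtain F1 V1 where F1: "computes F1 0 (\<lambda>k. ?F (2 ^ k)) V1"
    using computes_comp[OF F E] by blast
  obtain F2 V2 where F2: "computes F2 0 (\<lambda>k. ?F (2 ^ 2 ^ k)) V2"
    using computes_comp[OF F1 E] by blast
  obtain F3 V3 where F3: "computes F3 0 (\<lambda>k. ?F (?M k)) V3"
    using computes_comp[OF F2 G] by blast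
  have f: "computable (\<lambda>k. ?F (?M k))"
    by (rule computes_imp_computable[OF F3])
  let ?g = "1 + length P" let ?e = "?g + length G"
  let ?main = "Call 1 [NodeE (Var 0) (NodeE (Var 1) (Call ?e [Call ?e [Call ?g [Var 1]]]))]"
  let ?B = "[?main]"
  let ?R = "?B @ map (shift 1) P @ map (shift ?g) G @ map (shift ?e) E @ []"
  have P': "computes ?R 1 A T" by (rule computes_embed[OF P]) simp
  have G': "computes ?R ?g g U" by (rule computes_embed2[OF G]) simp
  have E': "computes ?R ?e (\<lambda>n. 2 ^ n :: nat) (\<lambda>n. 25 * 2 ^ n)"
    using computes_embed2[OF E, of "?B @ map (shift 1) P" "map (shift ?g) G" ?e "[]"] by simp
  have R0: "?R ! 0 = ?main" by simp
  have "\<exists>t \<le> ?F (?M k) * instance_size x k ^ c.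
      runs ?R [string_tree x, nat_tree k] (bool_tree ((x, k) \<in> L)) t" for x k
  proof -
    let ?N = "instance_size x k"
    have "ev ?R [enc x, enc k] (?R ! 0) (enc (A (x, k, ?M k)))
       (T (x, k, ?M k) + 25 * 2 ^ 2 ^ g k + 25 * 2 ^ g k + U k + 10)"
      unfolding R0
      by (rule ev_cong, rule ev_Call1[OF P', where x = "(x, k, ?M k)"], (rule ev_intros ev_Call1[OF E'] ev_Call1[OF G'] refl | simp)+)
    moreover have "T (x, k, ?M k) + 25 * 2 ^ 2 ^ g k + 25 * 2 ^ g k + U k + 10 \<le> ?F (?M k) * ?N ^ c"
    proof -
      have N: "1 \<le> ?N" by (simp add: instance_size_def)
      have "esize (x, k, ?M k) + 2 \<le> 2 * ?N + ?M k + 4"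
        using esize_bools[of x] by (simp add: instance_size_def)
      \<comment> \<open>Since \<open>?N\<close> is at least 1, the sum of a size part and a
        parameter part is at most a product, whose power splits into the two factors
        required.\<close>
      also have "\<dots> \<le> (?M k + 6) * ?N"
        using N mult_le_mono2[OF N, of "?M k + 4"] by (simp add: algebra_simps)
      finally have "T (x, k, ?M k) \<le> ((?M k + 6) * ?N) ^ c"
        by (rule order_trans[OF T power_mono]) simp
      then have 1: "T (x, k, ?M k) \<le> (?M k + 6) ^ c * ?N ^ c"
        by (simp add: power_mult_distrib)
      have 2: "2 ^ g k \<le> ?M k"
        by (intro power_increasing) (auto intro: less_imp_le)
      \<comment> \<open>This is where \<open>k \<le> g k\<close> enters: the time for computing
        \<open>g\<close> is bounded in terms of the padding.\<close>
      have "k \<le> ?M k"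
        using g(2)[of k] less_exp[of "g k"] 2 by linarith
      then have 3: "U k \<le> (?M k + 6) ^ d"
        by (intro order_trans[OF U power_mono]) auto
      have "1 \<le> ?N ^ c" using N by simp
      then have "(50 * ?M k + (?M k + 6) ^ d + 20) * 1 \<le> (50 * ?M k + (?M k + 6) ^ d + 20) * ?N ^ c"
        by (rule mult_le_mono2)
      with 1 2 3 show ?thesis unfolding add_mult_distrib by linarith
    qed
    ultimately have "ev ?R [enc x, enc k] (?R ! 0) (enc ((x, k) \<in> L)) (?F (?M k) * ?N ^ c)"
      unfolding L by (rule ev_mono)
    moreover have "enc x = string_tree x" "enc k = nat_tree k" "enc ((x, k) \<in> L) = bool_tree ((x, k) \<in> L)"
      by (simp_all add: enc_list_def enc_nat_def enc_bool_def string_tree_def)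
    ultimately show ?thesis unfolding ev_def runs_def by simp
  qed
  then show ?thesis
    unfolding fixed_parameter_tractable_def using f by blast
qed

subsection \<open>Token moves\<close>

text \<open>Sliding is the case \<open>F = E\<close> and jumping the case
  \<open>F = V \<times> V\<close>; \<open>F = mac\<close> gives the moves on the kernel.\<close>

definition swap :: "'a rel \<Rightarrow> 'a set \<Rightarrow> 'a set \<Rightarrow> bool" where
  "swap F A B \<longleftrightarrow> (\<exists>u\<in>A. \<exists>v. v \<notin> A \<and> (u, v) \<in> F \<and> B = insert v (A - {u}))"

lemma swapI: "u \<in> A \<Longrightarrow> v \<notin> A \<Longrightarrow> (u, v) \<in> F \<Longrightarrow> swap F A (insert v (A - {u}))"
  unfolding swap_def by blast

lemma swap_sym:
  assumes "sym F" "swap F A B"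
  shows "swap F B A"
proof -
  obtain u v where *: "u \<in> A" "v \<notin> A" "(u, v) \<in> F" "B = insert v (A - {u})"
    using assms(2) unfolding swap_def by blast
  moreover have "A = insert u (B - {v})" using * by blast
  moreover have "u \<notin> B" using * by blast
  ultimately show ?thesis using assms(1) unfolding swap_def by (metis insertI1 symD)
qed

lemma swap_card: "swap F A B \<Longrightarrow> card B = card A"
proof -
  assume "swap F A B"
  then obtain u v where *: "u \<in> A" "v \<notin> A" "B = insert v (A - {u})"
    unfolding swap_def by blast
  show ?thesis
  proof (cases "finite A")
    case True
    then show ?thesis using * card_Suc_Diff1[of A u] by simp
  next
    case False
    then show ?thesis using * by simp
  qed
qed

lemma reconf_step_TS_iff_swap:
  assumes "finite A" "finite B"
  shows "reconf_step TS E A B \<longleftrightarrow> swap E A B"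
proof
  assume "reconf_step TS E A B"
  then obtain u v where uv: "A - B = {u}" "B - A = {v}" "(u, v) \<in> E" by auto
  then have "B = insert v (A - {u})" by blast
  then show "swap E A B" using uv unfolding swap_def by blast
next
  assume *: "swap E A B"
  then obtain u v where uv: "u \<in> A" "v \<notin> A" "(u, v) \<in> E" "B = insert v (A - {u})"
    unfolding swap_def by blast
  then have "A - B = {u}" "B - A = {v}" by auto
  then show "reconf_step TS E A B" using uv swap_card[OF *] by auto
qed

lemma reconf_step_TJ_iff_swap:
  assumes "finite A" "finite B" "A \<subseteq> V" "B \<subseteq> V"
  shows "reconf_step TJ E A B \<longleftrightarrow> swap (V \<times> V) A B"
proof
  assume *: "reconf_step TJ E A B"
  then have "card (A - B) = 1" "card A = card B" by auto
  then have "card (B - A) = 1"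
    using card_le_sym_Diff[of A B] card_le_sym_Diff[of B A] assms by simp
  with \<open>card (A - B) = 1\<close> obtain u v where uv: "A - B = {u}" "B - A = {v}"
    by (auto simp: card_1_singleton_iff)
  then have "B = insert v (A - {u})" by blast
  moreover have "u \<in> A" "v \<notin> A" "(u, v) \<in> V \<times> V" using uv assms(3,4) by auto
  ultimately show "swap (V \<times> V) A B" using swapI by metis
next
  assume *: "swap (V \<times> V) A B"
  then obtain u v where uv: "u \<in> A" "v \<notin> A" "B = insert v (A - {u})"
    unfolding swap_def by blast
  then have "A - B = {u}" by auto
  then show "reconf_step TJ E A B" using swap_card[OF *] by auto
qed

text \<open>What the token argument has to know about alliances: goodness is monotone and decided
  outside \<open>I\<close>. Moving a token away from a vertex of \<open>I\<close> thus never
  destroys it.\<close>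

locale token_system =
  fixes V I :: "'a set" and F :: "'a rel" and good :: "'a set \<Rightarrow> bool"
  assumes finite_V: "finite V"
    and sym_F: "sym F"
    and F_V: "F \<subseteq> V \<times> V"
    and good_V: "good A \<Longrightarrow> A \<subseteq> V"
    and good_mono: "good A \<Longrightarrow> A - I \<subseteq> B - I \<Longrightarrow> B \<subseteq> V \<Longrightarrow> good B"
begin

text \<open>Connectivity inside \<open>I\<close>. The closure is reflexive on all vertices, so a
  vertex outside \<open>I\<close> forms a class of its own.\<close>

definition conn :: "'a rel" where
  "conn = (F \<inter> I \<times> I)\<^sup>*"

text \<open>Adjacency after contracting the classes of \<open>conn\<close>; \<open>F\<^sup>=\<close>
  instead of \<open>F\<close> also relates all vertices of one class.\<close>

definition mac :: "'a rel" where
  "mac = conn O F\<^sup>= O conn"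

definition moves :: "'a set rel" where
  "moves = {(A, B). swap F A B \<and> good A \<and> good B}"

lemma sym_moves: "sym moves"
proof (rule symI)
  show "(B, A) \<in> moves" if "(A, B) \<in> moves" for A B
    using that swap_sym[OF sym_F, of A B] unfolding moves_def by simp
qed

lemma moves_rev: "(A, B) \<in> moves\<^sup>* \<Longrightarrow> (B, A) \<in> moves\<^sup>*"
  by (meson sym_moves sym_rtrancl symD)

lemma moves_step:
  "u \<in> A \<Longrightarrow> v \<notin> A \<Longrightarrow> (u, v) \<in> F \<Longrightarrow> good A \<Longrightarrow> good (insert v (A - {u})) \<Longrightarrow>
    (A, insert v (A - {u})) \<in> moves\<^sup>*"
  unfolding moves_def using swapI[of u A v F] by (intro r_into_rtrancl) simp

lemma conn_sym: "(u, v) \<in> conn \<Longrightarrow> (v, u) \<in> conn"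
proof -
  have "sym (F \<inter> I \<times> I)" using sym_F unfolding sym_def by blast
  then show "(u, v) \<in> conn \<Longrightarrow> (v, u) \<in> conn"
    unfolding conn_def by (meson sym_rtrancl symD)
qed

lemma conn_refl [simp]: "(u, u) \<in> conn"
  unfolding conn_def by simp

lemma conn_trans: "(u, v) \<in> conn \<Longrightarrow> (v, w) \<in> conn \<Longrightarrow> (u, w) \<in> conn"
  unfolding conn_def by simp

lemma conn_cases: "(u, v) \<in> conn \<Longrightarrow> u = v \<or> u \<in> I \<and> v \<in> I"
  unfolding conn_def by (induction rule: rtrancl_induct) auto

lemma conn_V: "(u, v) \<in> conn \<Longrightarrow> u \<in> V \<Longrightarrow> v \<in> V"
  unfolding conn_def by (induction rule: rtrancl_induct) (use F_V in auto)

lemma good_insert_I: "good A \<Longrightarrow> u \<in> I \<Longrightarrow> v \<in> V \<Longrightarrow> good (insert v (A - {u}))"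
  by (rule good_mono[of A]) (auto dest: good_V)

text \<open>The path may be occupied. If its last vertex \<open>w\<close> before \<open>v\<close>
  holds a token, that token moves on to \<open>v\<close> and the one from \<open>u\<close> takes its
  place; otherwise the token from \<open>u\<close> first goes to \<open>w\<close>. Either way the
  same set results.\<close>

lemma push:
  assumes "(u, v) \<in> conn" "u \<in> A" "v \<notin> A" "v \<in> V" "good A"
  shows "(A, insert v (A - {u})) \<in> moves\<^sup>*"
  using assms unfolding conn_def
proof (induction arbitrary: A rule: rtrancl_induct)
  case base
  then show ?case by simp
next
  case (step w v)
  have w: "w \<in> V" "w \<in> I" "v \<in> I" "(w, v) \<in> F" using step.hyps F_V by auto
  have u: "u \<in> I" "u = w \<or> u \<noteq> w"
    using step.hyps(1) w conn_cases[of u w] unfolding conn_def by auto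
  \<comment> \<open>The case \<open>w = v\<close> arises because \<open>F\<close> may contain loops,
    as \<open>V \<times> V\<close> does.\<close>
  consider "u = w" | "u \<noteq> w" "w \<in> A" | "w \<notin> A" "w \<noteq> v" | "w = v" by blast
  then show ?case
  proof cases
    case 1
    then show ?thesis using step.prems w by (intro moves_step good_insert_I) auto
  next
    case 2
    let ?A = "insert v (A - {w})"
    have g: "good ?A" using step.prems w by (intro good_insert_I) auto
    have "(A, ?A) \<in> moves\<^sup>*"
      using 2 step.prems w g by (intro moves_step) auto
    moreover have "(?A, insert w (?A - {u})) \<in> moves\<^sup>*"
      using 2 step.prems w g by (intro step.IH) auto
    moreover have "insert w (?A - {u}) = insert v (A - {u})" using 2 step.prems by auto
    ultimately show ?thesis by simp
  next
    case 3
    let ?A = "insert w (A - {u})"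
    have g: "good ?A" using step.prems w u by (intro good_insert_I) auto
    have "(A, ?A) \<in> moves\<^sup>*"
      using 3 step.prems w by (intro step.IH) auto
    moreover have eq: "insert v (?A - {w}) = insert v (A - {u})" using 3 step.prems by auto
    moreover have "(?A, insert v (?A - {w})) \<in> moves\<^sup>*"
      using 3 step.prems w g u by (intro moves_step good_insert_I) auto
    ultimately show ?thesis by simp
  next
    case 4
    then show ?thesis using step.IH step.prems by blast
  qed
qed

text \<open>If the exit \<open>w\<close> is occupied, its token leaves and the token from
  \<open>u\<close> is pushed into the gap; otherwise the token from \<open>u\<close> goes to
  \<open>w\<close> first. The intermediate sets are good because only vertices of \<open>I\<close>
  are vacated.\<close>

lemma push_out:
  assumes "(u, w) \<in> conn" "(w, v) \<in> F" "v \<notin> I" "u \<in> A" "v \<notin> A" "good A"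
    "good (insert v (A - {u}))"
  shows "(A, insert v (A - {u})) \<in> moves\<^sup>*"
proof (cases "u = w")
  case True
  then show ?thesis using assms by (intro moves_step) auto
next
  case False
  then have I: "u \<in> I" "w \<in> I" using conn_cases[OF assms(1)] by auto
  have V: "v \<in> V" "w \<in> V" using assms(2) F_V by auto
  show ?thesis
  proof (cases "w \<in> A")
    case True
    let ?A = "insert v (A - {w})"
    have g: "good ?A" using assms V I by (intro good_insert_I) auto
    have "(A, ?A) \<in> moves\<^sup>*" using True assms g by (intro moves_step) auto
    moreover have "(?A, insert w (?A - {u})) \<in> moves\<^sup>*"
      using False True assms V I g by (intro push) auto
    moreover have "insert w (?A - {u}) = insert v (A - {u})" using True False assms I by auto
    ultimately show ?thesis by simp
  next
    case wA: False
    let ?A = "insert w (A - {u})"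
    have g: "good ?A" using assms V I by (intro good_insert_I) auto
    have "(A, ?A) \<in> moves\<^sup>*" using wA assms V by (intro push) auto
    moreover have eq: "insert v (?A - {w}) = insert v (A - {u})" using wA assms I by auto
    moreover have "(?A, insert v (?A - {w})) \<in> moves\<^sup>*"
      using wA assms g I by (intro moves_step) (auto simp: eq)
    ultimately show ?thesis by simp
  qed
qed

text \<open>
  Tokens are indistinguishable, so a token that is in the way is moved in place of the one that
  should pass it.
\<close>

lemma swap_mac_imp_moves:
  assumes "swap mac A B" "good A" "good B"
  shows "(A, B) \<in> moves\<^sup>*"
proof -
  obtain u v where uv: "u \<in> A" "v \<notin> A" "(u, v) \<in> mac" and B: "B = insert v (A - {u})"
    using assms(1) unfolding swap_def by blast
  obtain u' v' where c: "(u, u') \<in> conn" "(u', v') \<in> F\<^sup>=" "(v', v) \<in> conn"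
    using uv(3) unfolding mac_def by blast
  have V: "v \<in> V" "u \<in> V" using assms(2,3) B uv good_V by auto
  show ?thesis
  proof (cases "(u, v) \<in> conn")
    case True
    then show ?thesis unfolding B using uv V assms(2) by (intro push)
  next
    case nc: False
    then have F: "(u', v') \<in> F" using c conn_trans by auto
    have "\<not> (u' \<in> I \<and> v' \<in> I)"
    proof
      assume "u' \<in> I \<and> v' \<in> I"
      then have "(u', v') \<in> conn" using F unfolding conn_def by auto
      then show False using nc c conn_trans by blast
    qed
    then consider "v' \<notin> I" | "u' \<notin> I" by blast
    then show ?thesis
    proof cases
      case 1
      then have "v' = v" using conn_cases[OF c(3)] by auto
      then show ?thesis unfolding B using 1 c(1) F uv assms(2,3) B by (intro push_out[of u u']) auto
    next
      case 2
      then have u: "u' = u" using conn_cases[OF c(1)] by auto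
      have A: "insert u (B - {v}) = A" using B uv by auto
      \<comment> \<open>A move into a component is the reverse of a move out of it.\<close>
      have "(B, insert u (B - {v})) \<in> moves\<^sup>*"
      proof (rule push_out)
        show "(v, v') \<in> conn" using c(3) by (rule conn_sym)
        show "(v', u) \<in> F" using F u sym_F by (auto dest: symD)
        show "u \<notin> I" using 2 u by simp
      qed (use B uv assms A in auto)
      then show ?thesis unfolding A by (rule moves_rev)
    qed
  qed
qed

end

text \<open>The change of a token count, written additively to avoid truncated subtraction;
  \<open>C = UNIV\<close> gives the total.\<close>

lemma card_swap_Int:
  assumes "finite A" "u \<in> A" "v \<notin> A"
  shows "card (insert v (A - {u}) \<inter> C) + of_bool (u \<in> C) = card (A \<inter> C) + of_bool (v \<in> C)"
proof -
  have "card ((A - {u}) \<inter> C) + of_bool (u \<in> C) = card (A \<inter> C)"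
  proof (cases "u \<in> C")
    case True
    then have "(A - {u}) \<inter> C = (A \<inter> C) - {u}" by blast
    then show ?thesis using True assms card_Suc_Diff1[of "A \<inter> C" u] by simp
  next
    case False
    then have "(A - {u}) \<inter> C = A \<inter> C" by blast
    then show ?thesis using False by simp
  qed
  then show ?thesis using assms by (auto simp: Int_insert_left)
qed

section \<open>Token counts per class and simulation inside a vertex subset\<close>

context token_system
begin

abbreviation "cls v \<equiv> conn `` {v}"

lemma cls_self: "v \<in> cls v"
  by simp

lemma mem_cls_cong: "(u, v) \<in> conn \<Longrightarrow> u \<in> cls w \<longleftrightarrow> v \<in> cls w"
  using conn_trans[of w u v] conn_trans[of w v u] conn_sym[of u v] by auto

lemma cls_singleton: "v \<notin> I \<Longrightarrow> cls v = {v}"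
  using conn_cases by auto

text \<open>Similar sets agree outside \<open>I\<close>, where classes are singletons; they may
  differ in which vertices of an idle component are occupied.\<close>

definition sim :: "'a set \<Rightarrow> 'a set \<Rightarrow> bool" where
  "sim A B \<longleftrightarrow> card A = card B \<and> (\<forall>v. card (A \<inter> cls v) = card (B \<inter> cls v))"

lemma sim_good:
  assumes "sim A B" "good A" "B \<subseteq> V"
  shows "good B"
proof (rule good_mono[OF assms(2) _ assms(3)])
  show "A - I \<subseteq> B - I"
  proof
    fix v
    assume v: "v \<in> A - I"
    then have "A \<inter> cls v = {v}" using cls_singleton[of v] by auto
    then have "card (B \<inter> cls v) = 1" using assms(1) unfolding sim_def by (metis card_1_singleton_iff One_nat_def)
    then have "B \<inter> cls v \<noteq> {}" by auto
    then show "v \<in> B - I" using v cls_singleton[of v] by auto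
  qed
qed

definition mac_moves :: "'a set \<Rightarrow> 'a set rel" where
  "mac_moves U = {(A, B). A \<subseteq> U \<and> B \<subseteq> U \<and> good A \<and> good B \<and> swap mac A B}"

text \<open>A vertex \<open>v\<close> of \<open>B - A\<close> has a partner \<open>u\<close> of
  \<open>A - B\<close> in its class, because both sets have equally many tokens there. A move from
  \<open>u\<close> to \<open>v\<close> is a single \<open>mac\<close> step, keeps all counts and
  shrinks \<open>B - A\<close>.\<close>

lemma sim_imp_mac_moves:
  assumes "sim A B" "good A" "A \<subseteq> U" "B \<subseteq> U" "U \<subseteq> V"
  shows "(A, B) \<in> (mac_moves U)\<^sup>*"
  using assms
proof (induction "card (B - A)" arbitrary: A rule: less_induct)
  case less
  note fin = finite_subset[OF less.prems(3) finite_subset[OF less.prems(5) finite_V]]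
    finite_subset[OF less.prems(4) finite_subset[OF less.prems(5) finite_V]]
  show ?case
  proof (cases "B \<subseteq> A")
    case True
    then have "B = A"
      using less.prems(1) fin unfolding sim_def by (intro card_subset_eq) auto
    then show ?thesis by simp
  next
    case False
    then obtain v where v: "v \<in> B" "v \<notin> A" by blast
    have "\<not> A \<inter> cls v \<subseteq> B"
    proof
      assume "A \<inter> cls v \<subseteq> B"
      then have "A \<inter> cls v \<subset> B \<inter> cls v" using v cls_self[of v] by blast
      then have "card (A \<inter> cls v) < card (B \<inter> cls v)" using fin by (intro psubset_card_mono) auto
      then show False using less.prems(1) unfolding sim_def by simp
    qed
    then obtain u where u: "u \<in> A" "u \<notin> B" "(v, u) \<in> conn" by blast
    let ?A = "insert v (A - {u})"
    have "card (?A \<inter> cls w) = card (A \<inter> cls w)" for w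
      using card_swap_Int[of A u v "cls w"] fin u v mem_cls_cong[OF u(3), of w] by simp
    moreover have "card ?A = card A"
      using card_swap_Int[of A u v UNIV] fin u v by simp
    ultimately have "sim ?A B" "sim A ?A" using less.prems(1) unfolding sim_def by auto
    moreover have sub: "?A \<subseteq> U" using v less.prems by auto
    moreover have g: "good ?A" using sim_good[OF \<open>sim A ?A\<close>] less.prems sub by auto
    moreover have "card (B - ?A) < card (B - A)"
      using fin v u by (intro psubset_card_mono) auto
    ultimately have "(?A, B) \<in> (mac_moves U)\<^sup>*"
      using less.prems by (intro less.hyps) auto
    moreover have "(u, v) \<in> mac"
      unfolding mac_def using conn_sym[OF u(3)] conn_refl by blast
    then have "(A, ?A) \<in> mac_moves U"
      unfolding mac_moves_def using sub g less.prems swapI[OF u(1) v(2)] by simp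
    ultimately show ?thesis by (rule converse_rtrancl_into_rtrancl[rotated])
  qed
qed

text \<open>Every set \<open>A\<close> on the way is shadowed by a similar set \<open>B\<close>
  inside \<open>U\<close>. A move within a class leaves \<open>B\<close> as it is; a move between
  classes is copied with other vertices of the same two classes. The capacity condition on
  \<open>U\<close> concerns only classes of \<open>I\<close> entered from outside \<open>I\<close>
  and \<open>H\<close>, as tokens on \<open>H\<close> never move.\<close>

lemma moves_imp_mac_moves:
  assumes UV: "U \<subseteq> V" and IU: "V - I \<subseteq> U"
    and H: "\<And>A. good A \<Longrightarrow> H \<subseteq> A"
    and U: "\<And>u v. (u, v) \<in> F \<Longrightarrow> u \<notin> I \<Longrightarrow> u \<notin> H \<Longrightarrow> v \<in> I \<Longrightarrow>
      cls v \<subseteq> U \<or> k \<le> card (U \<inter> cls v)"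
    and S: "S \<subseteq> U" "good S" "card S \<le> k" and T: "T \<subseteq> U" and "(S, T) \<in> moves\<^sup>*"
  shows "(S, T) \<in> (mac_moves U)\<^sup>*"
proof -
  have "\<exists>B. sim A B \<and> B \<subseteq> U \<and> good A \<and> (S, B) \<in> (mac_moves U)\<^sup>*" if "(S, A) \<in> moves\<^sup>*" for A
    using that
  proof (induction rule: rtrancl_induct)
    case base
    then show ?case using S by (auto simp: sim_def)
  next
    case (step A A')
    then obtain B where B: "sim A B" "B \<subseteq> U" "good A" "(S, B) \<in> (mac_moves U)\<^sup>*" by blast
    have "(A, A') \<in> moves" by (rule step.hyps)
    then obtain u v where uv: "u \<in> A" "v \<notin> A" "(u, v) \<in> F" and A': "A' = insert v (A - {u})"
      and g: "good A'"
      unfolding moves_def swap_def by blast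
    have fin: "finite A" "finite B" "finite U"
      using B UV good_V[of A] by (auto intro: finite_subset[OF _ finite_V])
    have goodB: "good B" using sim_good[OF B(1,3)] B(2) UV by auto
    show ?case
    proof (cases "(u, v) \<in> conn")
      case True
      have "card (A' \<inter> cls w) = card (A \<inter> cls w)" for w
        using card_swap_Int[of A u v "cls w"] fin uv mem_cls_cong[OF True, of w] A' by simp
      moreover have "card A' = card A"
        using card_swap_Int[of A u v UNIV] fin uv A' by simp
      ultimately have "sim A' B" using B(1) unfolding sim_def by auto
      then show ?thesis using B g by blast
    next
      case False
      have cu: "card (A \<inter> cls u) = card (B \<inter> cls u)" and cv: "card (A \<inter> cls v) = card (B \<inter> cls v)"
        and cAB: "card A = card B"
        using B(1) unfolding sim_def by auto
      have "A \<inter> cls u \<noteq> {}" using uv(1) cls_self[of u] by blast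
      then have "B \<inter> cls u \<noteq> {}" using cu fin by (metis card_eq_0_iff finite_Int)
      then obtain u' where u': "u' \<in> B" "(u, u') \<in> conn" by blast
      \<comment> \<open>The class that is entered must have a vacancy inside \<open>U\<close>; the
        count in \<open>B\<close> equals the count in \<open>A\<close>.\<close>
      have "\<not> U \<inter> cls v \<subseteq> B"
      proof
        assume "U \<inter> cls v \<subseteq> B"
        then have le: "card (U \<inter> cls v) \<le> card (A \<inter> cls v)"
          unfolding cv using fin by (intro card_mono) auto
        have vV: "v \<in> V" using uv F_V by auto
        have "cls v \<subseteq> U \<or> k \<le> card (U \<inter> cls v)"
        proof (cases "v \<in> I")
          case True
          \<comment> \<open>An edge between two vertices of \<open>I\<close> would belong to
            \<open>conn\<close>; and a vertex of \<open>H\<close> cannot be vacated, as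
            \<open>A'\<close> is good.\<close>
          then have "u \<notin> I" using False uv(3) unfolding conn_def by auto
          moreover have "u \<notin> H" using H[OF g] A' uv by auto
          ultimately show ?thesis using U uv(3) True by blast
        next
          case False
          then show ?thesis using cls_singleton[of v] IU vV by auto
        qed
        then show False
        proof
          assume "cls v \<subseteq> U"
          then have "U \<inter> cls v = cls v" "finite (cls v)" using fin finite_subset by auto
          moreover have "A \<inter> cls v \<subset> cls v" using uv(2) cls_self[of v] by blast
          ultimately show False using le psubset_card_mono[of "cls v" "A \<inter> cls v"] by simp
        next
          assume "k \<le> card (U \<inter> cls v)"
          also note le
          \<comment> \<open>The moving token itself lies outside the class of \<open>v\<close>,
            hence the strict inequality.\<close>
          also have "card (A \<inter> cls v) < card A"
          proof (rule psubset_card_mono)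
            have "u \<notin> cls v" using False conn_sym by blast
            then show "A \<inter> cls v \<subset> A" using uv(1) by blast
          qed (rule fin)
          finally have "k < card A" .
          moreover have "card A = card S"
            using \<open>(S, A) \<in> moves\<^sup>*\<close> by (induction rule: rtrancl_induct) (auto simp: moves_def dest: swap_card)
          ultimately show False using S(3) by simp
        qed
      qed
      then obtain v' where v': "v' \<in> U" "v' \<notin> B" "(v, v') \<in> conn" by blast
      let ?B = "insert v' (B - {u'})"
      have "card (?B \<inter> cls w) = card (A' \<inter> cls w)" for w
      proof -
        have "card (A \<inter> cls w) = card (B \<inter> cls w)" using B(1) unfolding sim_def by blast
        then show ?thesis
          using card_swap_Int[of A u v "cls w"] card_swap_Int[of B u' v' "cls w"] fin uv u' v'
            mem_cls_cong[OF u'(2), of w] mem_cls_cong[OF v'(3), of w] A' by simp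
      qed
      moreover have "card ?B = card A'"
        using card_swap_Int[of A u v UNIV] card_swap_Int[of B u' v' UNIV] fin uv u' v' A' cAB by simp
      ultimately have s: "sim A' ?B" unfolding sim_def by auto
      have sub: "?B \<subseteq> U" using B v' by auto
      have g': "good ?B" using sim_good[OF s g] sub UV by auto
      have "(u', v') \<in> mac"
        unfolding mac_def using conn_sym[OF u'(2)] uv(3) v'(3) by blast
      then have "swap mac B ?B" using swapI[OF u'(1) v'(2)] by blast
      then have "(B, ?B) \<in> mac_moves U"
        unfolding mac_moves_def using B sub goodB g' by auto
      then show ?thesis using s sub g B(4) by (meson rtrancl.rtrancl_into_rtrancl)
    qed
  qed
  from this[OF assms(9)] obtain B where B: "sim T B" "B \<subseteq> U" "good T" "(S, B) \<in> (mac_moves U)\<^sup>*"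
    by blast
  have "sim B T" using B(1) unfolding sim_def by simp
  moreover have "good B" using sim_good[OF B(1,3)] B(2) UV by auto
  ultimately have "(B, T) \<in> (mac_moves U)\<^sup>*"
    using B(2) T UV by (intro sim_imp_mac_moves)
  with B(4) show ?thesis by (rule rtrancl_trans)
qed

lemma mac_moves_imp_moves:
  assumes "(A, B) \<in> (mac_moves U)\<^sup>*"
  shows "(A, B) \<in> moves\<^sup>*"
  using assms
proof (induction rule: rtrancl_induct)
  case (step B C)
  then have "(B, C) \<in> moves\<^sup>*"
    unfolding mac_moves_def by (auto intro: swap_mac_imp_moves)
  with step.IH show ?case by (rule rtrancl_trans)
qed simp

end

subsection \<open>Alliances of bounded size\<close>

text \<open>For a dominating set the boundary is \<open>V - A\<close>, and the total degree splits
  into the degrees in \<open>A\<close> and in \<open>V - A\<close>. Conversely, a strict majority in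
  \<open>A\<close> provides a neighbour in \<open>A\<close>, which gives domination.\<close>

lemma global_offensive_alliance_iff:
  assumes "simple_graph V E"
  shows "global_offensive_alliance V E A \<longleftrightarrow>
    A \<subseteq> V \<and> (\<forall>v\<in>V - A. degree_in E V v < 2 * degree_in E A v)"
proof -
  have nbh: "nbh E v \<subseteq> V" "finite V" for v
    using assms unfolding simple_graph_def nbh_def by auto
  have split: "degree_in E V v = degree_in E A v + degree_in E (V - A) v" if "A \<subseteq> V" for v
  proof -
    have "nbh E v \<inter> V = (nbh E v \<inter> A) \<union> (nbh E v \<inter> (V - A))" using that by blast
    moreover have "finite (nbh E v)" using nbh finite_subset by blast
    ultimately show ?thesis unfolding degree_in_def by (auto intro: card_Un_disjoint)
  qed
  show ?thesis
  proof
    assume A: "global_offensive_alliance V E A"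
    then have sub: "A \<subseteq> V" and dom: "closed_nbh E A = V"
      unfolding global_offensive_alliance_def dominating_set_def by auto
    have "degree_in E V v < 2 * degree_in E A v" if "v \<in> V - A" for v
    proof -
      have "v \<in> boundary E A" using that dom unfolding boundary_def by auto
      then show ?thesis using A split[OF sub, of v]
        unfolding global_offensive_alliance_def offensive_alliance_def by auto
    qed
    then show "A \<subseteq> V \<and> (\<forall>v\<in>V - A. degree_in E V v < 2 * degree_in E A v)" using sub by blast
  next
    assume A: "A \<subseteq> V \<and> (\<forall>v\<in>V - A. degree_in E V v < 2 * degree_in E A v)"
    have cl: "closed_nbh E A \<subseteq> V" using A nbh unfolding closed_nbh_def by blast
    have "v \<in> closed_nbh E A" if "v \<in> V - A" for v
    proof -
      have "degree_in E V v < 2 * degree_in E A v" using A that by blast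
      then have "0 < degree_in E A v" by simp
      then obtain u where "(v, u) \<in> E" "u \<in> A"
        unfolding degree_in_def nbh_def by (auto simp: card_gt_0_iff)
      then show ?thesis using assms unfolding simple_graph_def closed_nbh_def nbh_def
        by (auto dest: symD)
    qed
    then have "closed_nbh E A = V" using cl unfolding closed_nbh_def by blast
    moreover have "degree_in E (V - A) v + 1 \<le> degree_in E A v" if "v \<in> V - A" for v
    proof -
      have "degree_in E V v < 2 * degree_in E A v" using A that by blast
      then show ?thesis using split[of v] A by linarith
    qed
    ultimately show "global_offensive_alliance V E A"
      using A unfolding global_offensive_alliance_def dominating_set_def offensive_alliance_def
        boundary_def by simp
  qed
qed

text \<open>The threshold comes from
  \<open>degree_in E V v < 2 * degree_in E A v \<le> 2 * card A\<close> for a vertex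
  \<open>v\<close> outside an alliance \<open>A\<close>.\<close>

definition heavy :: "'a set \<Rightarrow> 'a rel \<Rightarrow> nat \<Rightarrow> 'a set" where
  "heavy V E k = {v \<in> V. 2 * k \<le> degree_in E V v}"

definition bad :: "'a set \<Rightarrow> 'a rel \<Rightarrow> nat \<Rightarrow> 'a set" where
  "bad V E k = {v \<in> V. v \<notin> heavy V E k \<and> 2 * degree_in E (heavy V E k) v \<le> degree_in E V v}"

definition core :: "'a set \<Rightarrow> 'a rel \<Rightarrow> nat \<Rightarrow> 'a set" where
  "core V E k = {v \<in> V. v \<notin> heavy V E k \<and> (v \<in> bad V E k \<or> (\<exists>b\<in>bad V E k. (v, b) \<in> E))}"

definition idle :: "'a set \<Rightarrow> 'a rel \<Rightarrow> nat \<Rightarrow> 'a set" where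
  "idle V E k = {v \<in> V. v \<notin> heavy V E k \<and> v \<notin> core V E k}"

text \<open>The alliance condition for sets of size at most \<open>k\<close>, without the size: this
  makes it monotone without restriction, as \<open>token_system\<close> demands.\<close>

definition good :: "'a set \<Rightarrow> 'a rel \<Rightarrow> nat \<Rightarrow> 'a set \<Rightarrow> bool" where
  "good V E k A \<longleftrightarrow> A \<subseteq> V \<and> heavy V E k \<subseteq> A \<and>
    (\<forall>v\<in>bad V E k - A. degree_in E V v < 2 * degree_in E A v)"

locale graph =
  fixes V :: "'a set" and E :: "'a rel" and k :: nat
  assumes simple: "simple_graph V E"
begin

abbreviation "H \<equiv> heavy V E k"
abbreviation "B \<equiv> bad V E k"
abbreviation "R \<equiv> core V E k"
abbreviation "I \<equiv> idle V E k"

lemma finite_V: "finite V" and E_V: "E \<subseteq> V \<times> V" and sym_E: "sym E"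
  using simple unfolding simple_graph_def by auto

lemma nbh_V: "nbh E v \<subseteq> V"
  using E_V unfolding nbh_def by auto

lemma finite_nbh: "finite (nbh E v)"
  using nbh_V finite_V by (rule finite_subset)

lemma degree_in_mono: "nbh E v \<inter> A \<subseteq> C \<Longrightarrow> degree_in E A v \<le> degree_in E C v"
  unfolding degree_in_def using finite_nbh by (intro card_mono) auto

lemma V_minus_idle: "V - I = H \<union> R"
  unfolding idle_def heavy_def core_def by auto

text \<open>From left to right, a heavy vertex outside \<open>A\<close> would need more than
  \<open>k\<close> neighbours in \<open>A\<close>. From right to left, an outside vertex that is not
  bad already has its majority in \<open>H\<close>, which is contained in \<open>A\<close>.\<close>

lemma alliance_iff_good:
  assumes "finite A" "card A \<le> k"
  shows "global_offensive_alliance V E A \<longleftrightarrow> good V E k A"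
proof
  assume "global_offensive_alliance V E A"
  then have A: "A \<subseteq> V" "\<And>v. v \<in> V - A \<Longrightarrow> degree_in E V v < 2 * degree_in E A v"
    using global_offensive_alliance_iff[OF simple] by auto
  have "v \<in> A" if "v \<in> H" for v
  proof (rule ccontr)
    assume "v \<notin> A"
    then have "degree_in E V v < 2 * degree_in E A v" using A that unfolding heavy_def by auto
    also have "degree_in E A v \<le> card A" unfolding degree_in_def using assms by (intro card_mono) auto
    finally show False using assms that unfolding heavy_def by auto
  qed
  then show "good V E k A" using A unfolding good_def bad_def by auto
next
  assume g: "good V E k A"
  have "degree_in E V v < 2 * degree_in E A v" if v: "v \<in> V - A" for v
  proof (cases "v \<in> B")
    case True
    then show ?thesis using g v unfolding good_def by auto
  next
    case False
    then have "degree_in E V v < 2 * degree_in E H v" using g v unfolding good_def bad_def by auto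
    also have "degree_in E H v \<le> degree_in E A v"
      using g unfolding good_def by (intro degree_in_mono) auto
    finally show ?thesis by simp
  qed
  then show "global_offensive_alliance V E A"
    using g global_offensive_alliance_iff[OF simple] unfolding good_def by auto
qed

text \<open>Neither a bad vertex nor any of its neighbours is idle: the neighbours are heavy or in
  the core. So the degrees that matter are counted outside \<open>I\<close>.\<close>

lemma good_mono:
  assumes g: "good V E k A" and sub: "A - I \<subseteq> C - I" and C: "C \<subseteq> V"
  shows "good V E k C"
proof -
  have "H \<subseteq> C" using g sub unfolding good_def idle_def by blast
  moreover have "degree_in E V v < 2 * degree_in E C v" if v: "v \<in> B - C" for v
  proof -
    have "v \<notin> I" using v unfolding idle_def core_def bad_def by auto
    then have "v \<in> B - A" using v sub by auto
    then have "degree_in E V v < 2 * degree_in E A v" using g unfolding good_def by blast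
    also have "degree_in E A v \<le> degree_in E C v"
    proof (rule degree_in_mono)
      have "u \<notin> I" if "u \<in> nbh E v" for u
        using that v sym_E unfolding idle_def core_def nbh_def by (auto dest: symD)
      then show "nbh E v \<inter> A \<subseteq> C" using sub by blast
    qed
    finally show ?thesis by simp
  qed
  ultimately show ?thesis using C unfolding good_def by blast
qed

lemma token_system:
  assumes "sym F" "F \<subseteq> V \<times> V"
  shows "token_system V I F (good V E k)"
proof
  show "good V E k A \<Longrightarrow> A \<subseteq> V" for A by (simp add: good_def)
  show "good V E k A \<Longrightarrow> A - I \<subseteq> C - I \<Longrightarrow> C \<subseteq> V \<Longrightarrow> good V E k C" for A C
    by (rule good_mono)
qed (use assms finite_V in auto)

text \<open>The degree is strictly below \<open>2 * k\<close>, which leaves room for the vertex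
  itself.\<close>

lemma card_closed_nbh:
  assumes "v \<in> V" "v \<notin> H"
  shows "card (insert v (nbh E v)) \<le> 2 * k"
proof -
  have "nbh E v \<inter> V = nbh E v" using nbh_V by blast
  then have "card (nbh E v) < 2 * k" using assms unfolding heavy_def degree_in_def by auto
  then show ?thesis using finite_nbh[of v] by (simp add: card_insert_if)
qed

lemma card_UN_closed_nbh:
  assumes "C \<subseteq> V - H" "card C \<le> m"
  shows "card (\<Union>v\<in>C. insert v (nbh E v)) \<le> m * (2 * k)"
proof -
  have "card (\<Union>v\<in>C. insert v (nbh E v)) \<le> (\<Sum>v\<in>C. card (insert v (nbh E v)))"
    using assms finite_V by (intro card_UN_le) (auto intro: finite_subset)
  also have "\<dots> \<le> card C * (2 * k)"
    using sum_bounded_above[of C "\<lambda>v. card (insert v (nbh E v))" "2 * k"] card_closed_nbh assms by auto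
  also have "\<dots> \<le> m * (2 * k)" using assms by (intro mult_right_mono) auto
  finally show ?thesis .
qed

text \<open>
  A vertex whose neighbours in the alliance are all heavy is either in the alliance or has a
  majority of heavy neighbours, that is, it is not bad.
\<close>

lemma bad_subset:
  assumes "good V E k A"
  shows "B \<subseteq> (\<Union>v\<in>A - H. insert v (nbh E v))"
proof
  fix v
  assume v: "v \<in> B"
  show "v \<in> (\<Union>v\<in>A - H. insert v (nbh E v))"
  proof (rule ccontr)
    assume n: "v \<notin> (\<Union>v\<in>A - H. insert v (nbh E v))"
    then have "v \<notin> A" using v unfolding bad_def by auto
    then have "degree_in E V v < 2 * degree_in E A v" using v assms unfolding good_def by auto
    also have "degree_in E A v \<le> degree_in E H v"
    proof (rule degree_in_mono)
      show "nbh E v \<inter> A \<subseteq> H"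
        using n sym_E unfolding nbh_def by (auto dest: symD)
    qed
    finally show False using v unfolding bad_def by auto
  qed
qed

text \<open>At most \<open>k\<close> non-heavy vertices of \<open>A\<close> have closed
  neighbourhoods of size at most \<open>2 * k\<close>, which cover \<open>B\<close>; the closed
  neighbourhoods of these \<open>2 * k ^ 2\<close> vertices cover the core.\<close>

lemma card_core:
  assumes "good V E k A" "card A \<le> k"
  shows "card R \<le> 4 * k ^ 3"
proof -
  have A: "A \<subseteq> V" using assms unfolding good_def by auto
  have fin: "finite (\<Union>v\<in>C. insert v (nbh E v))" if "C \<subseteq> V" for C
    using that finite_nbh finite_V by (auto intro: finite_subset)
  have "card (A - H) \<le> k"
    using card_mono[of A "A - H"] A finite_V assms(2) by (auto dest: finite_subset)
  then have "card (\<Union>v\<in>A - H. insert v (nbh E v)) \<le> k * (2 * k)"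
    using A by (intro card_UN_closed_nbh) auto
  moreover have "card B \<le> card (\<Union>v\<in>A - H. insert v (nbh E v))"
    using A by (intro card_mono bad_subset assms fin) auto
  ultimately have "card B \<le> k * (2 * k)" by simp
  then have "card (\<Union>v\<in>B. insert v (nbh E v)) \<le> k * (2 * k) * (2 * k)"
    by (intro card_UN_closed_nbh) (auto simp: bad_def)
  moreover have "R \<subseteq> (\<Union>v\<in>B. insert v (nbh E v))"
    using sym_E unfolding core_def nbh_def by (auto dest: symD)
  then have "card R \<le> card (\<Union>v\<in>B. insert v (nbh E v))"
    by (intro card_mono fin) (auto simp: bad_def)
  ultimately show ?thesis by (simp add: power3_eq_cube)
qed

end

text \<open>\<open>P a\<close> is a separate conjunct because the closure relates every
  \<open>a\<close> to itself.\<close>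

lemma successively_iff_rtrancl:
  "(\<exists>xs. xs \<noteq> [] \<and> hd xs = a \<and> last xs = b \<and> (\<forall>x\<in>set xs. P x) \<and> successively r xs) \<longleftrightarrow>
    P a \<and> (a, b) \<in> {(x, y). P x \<and> P y \<and> r x y}\<^sup>*" (is "?L \<longleftrightarrow> ?R")
proof
  have "P (hd xs) \<and> (hd xs, last xs) \<in> {(x, y). P x \<and> P y \<and> r x y}\<^sup>*"
    if "xs \<noteq> []" "\<forall>x\<in>set xs. P x" "successively r xs" for xs
    using that
  proof (induction xs rule: list_nonempty_induct)
    case (cons x xs)
    then have "(hd xs, last xs) \<in> {(x, y). P x \<and> P y \<and> r x y}\<^sup>*" "P x" "P (hd xs)" "r x (hd xs)"
      by (auto simp: successively_Cons)
    then show ?case using cons.hyps by (auto intro: converse_rtrancl_into_rtrancl)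
  qed auto
  then show "?L \<Longrightarrow> ?R" by blast
next
  assume R: ?R
  then have "(a, b) \<in> {(x, y). P x \<and> P y \<and> r x y}\<^sup>*" "P a" by auto
  then show ?L
  proof (induction rule: converse_rtrancl_induct)
    case base
    then show ?case by (intro exI[of _ "[b]"]) auto
  next
    case (step x y)
    then obtain xs where "xs \<noteq> []" "hd xs = y" "last xs = b" "\<forall>x\<in>set xs. P x" "successively r xs"
      by auto
    then show ?case using step.hyps step.prems
      by (intro exI[of _ "x # xs"]) (auto simp: successively_Cons)
  qed
qed

text \<open>Translates a sequence step by step into another relation while carrying an invariant; in
  its applications the invariant is the size bound \<open>k\<close>.\<close>

lemma rtrancl_invariant:
  assumes "(a, b) \<in> r\<^sup>*" "P a" "\<And>x y. P x \<Longrightarrow> (x, y) \<in> r \<Longrightarrow> P y \<and> (x, y) \<in> s\<^sup>*"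
  shows "P b \<and> (a, b) \<in> s\<^sup>*"
  using assms(1)
proof (induction rule: rtrancl_induct)
  case (step y z)
  then show ?case using assms(3)[of y z] by (auto intro: rtrancl_trans)
qed (use assms(2) in auto)

subsection \<open>The kernel\<close>

text \<open>The \<open>k\<close> smallest elements, given by rank. The choice is canonical because
  the kernel evaluates it separately at every member of a class and has to obtain the same set each
  time.\<close>

definition lowest :: "nat \<Rightarrow> nat set \<Rightarrow> nat set" where
  "lowest k C = {v \<in> C. card {w \<in> C. w < v} < k}"

lemma inj_on_rank:
  assumes "finite (C :: nat set)"
  shows "inj_on (\<lambda>v. card {w \<in> C. w < v}) C"
proof (rule linorder_inj_onI)
  fix u v
  assume "u < v" "u \<in> C" "v \<in> C"
  then have "{w \<in> C. w < u} \<subset> {w \<in> C. w < v}" by auto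
  then have "card {w \<in> C. w < u} < card {w \<in> C. w < v}"
    using assms by (intro psubset_card_mono) auto
  then show "card {w \<in> C. w < u} \<noteq> card {w \<in> C. w < v}" by simp
qed auto

lemma card_lowest:
  assumes "finite C"
  shows "card (lowest k C) \<le> k"
proof -
  have "card (lowest k C) \<le> card {..<k}"
  proof (rule card_inj_on_le)
    show "inj_on (\<lambda>v. card {w \<in> C. w < v}) (lowest k C)"
      using inj_on_rank[OF assms] by (rule inj_on_subset) (auto simp: lowest_def)
  qed (auto simp: lowest_def)
  then show ?thesis by simp
qed

text \<open>The ranks in \<open>C\<close> fill \<open>{..<card C}\<close>. If \<open>C\<close> has
  at least \<open>k\<close> elements, every number below \<open>k\<close> is the rank of a chosen
  one; otherwise all ranks are below \<open>k\<close>. This is the alternative in the capacity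
  condition of \<open>moves_imp_mac_moves\<close>.\<close>

lemma lowest_cases:
  assumes "finite C"
  shows "C \<subseteq> lowest k C \<or> k \<le> card (lowest k C)"
proof (cases "k \<le> card C")
  case True
  let ?r = "\<lambda>v. card {w \<in> C. w < v}"
  have r: "?r v < card C" if "v \<in> C" for v
    using that assms by (intro psubset_card_mono) auto
  have "?r ` C = {..<card C}"
    using inj_on_rank[OF assms] r by (intro card_subset_eq) (auto simp: card_image)
  have "{..<k} \<subseteq> ?r ` lowest k C"
  proof
    fix i
    assume i: "i \<in> {..<k}"
    then have "i \<in> ?r ` C" unfolding \<open>?r ` C = _\<close> using True by simp
    then obtain v where "v \<in> C" "i = ?r v" by blast
    then show "i \<in> ?r ` lowest k C" using i unfolding lowest_def by blast
  qed
  then have "card {..<k} \<le> card (lowest k C)"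
    using assms by (intro surj_card_le) (auto simp: lowest_def)
  then show ?thesis by simp
next
  case False
  have "?thesis" if "v \<in> C" "\<not> card {w \<in> C. w < v} < k" for v
    using psubset_card_mono[OF assms, of "{w \<in> C. w < v}"] that False by auto
  then show ?thesis unfolding lowest_def by blast
qed

text \<open>Heavy vertices enter through \<open>S\<close>, which contains all of them. Idle
  components without a neighbour in the core contribute only what \<open>S\<close> and
  \<open>T\<close> occupy.\<close>

definition kernel :: "nat set \<Rightarrow> nat rel \<Rightarrow> nat \<Rightarrow> nat rel \<Rightarrow> nat set \<Rightarrow> nat set \<Rightarrow> nat set" where
  "kernel V E k F S T = {v \<in> V. v \<in> S \<or> v \<in> T \<or> v \<in> core V E k \<or>
     (\<exists>w\<in>token_system.conn (idle V E k) F `` {v}. \<exists>r\<in>core V E k. (r, w) \<in> F) \<and>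
     v \<in> lowest k (token_system.conn (idle V E k) F `` {v})}"

locale alliance_pair = graph V E k for V :: "nat set" and E k +
  fixes F S T
  assumes S: "global_offensive_alliance V E S" "card S \<le> k"
    and T: "global_offensive_alliance V E T" "card T \<le> k"
    and F: "sym F" "F \<subseteq> V \<times> V"
begin

sublocale tok: token_system V I F "good V E k"
  by (rule token_system[OF F])

abbreviation "U \<equiv> kernel V E k F S T"

lemma alliance_V: "global_offensive_alliance V E A \<Longrightarrow> A \<subseteq> V"
  unfolding global_offensive_alliance_def dominating_set_def by blast

lemma alliance_finite: "global_offensive_alliance V E A \<Longrightarrow> finite A"
  using alliance_V finite_V finite_subset by blast

lemma alliance_good: "global_offensive_alliance V E A \<Longrightarrow> card A \<le> k \<Longrightarrow> good V E k A"
  using alliance_iff_good[of A] alliance_V[of A] finite_V finite_subset by blast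

lemma good_alliance: "good V E k A \<Longrightarrow> card A \<le> k \<Longrightarrow> global_offensive_alliance V E A"
  using alliance_iff_good[of A] tok.good_V[of A] finite_V finite_subset by blast

lemma good_ST: "good V E k S" "good V E k T"
  using S T alliance_good by auto

lemma kernel_facts: "U \<subseteq> V" "S \<subseteq> U" "T \<subseteq> U" "V - I \<subseteq> U"
proof -
  show "S \<subseteq> U" "T \<subseteq> U" using alliance_V[OF S(1)] alliance_V[OF T(1)] unfolding kernel_def by auto
  have "R \<subseteq> U" unfolding kernel_def core_def by auto
  moreover have "H \<subseteq> S" using good_ST unfolding good_def by auto
  ultimately show "V - I \<subseteq> U" using \<open>S \<subseteq> U\<close> unfolding V_minus_idle by blast
qed (auto simp: kernel_def)

lemma finite_cls: "v \<in> V \<Longrightarrow> finite (tok.cls v)"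
  using tok.conn_V finite_V by (auto intro: finite_subset[of _ V])

lemma cls_eq: "(u, v) \<in> tok.conn \<Longrightarrow> tok.cls u = tok.cls v"
  using tok.mem_cls_cong[of u v] tok.conn_sym by (auto simp: set_eq_iff)

text \<open>The capacity condition holds because a vertex outside \<open>I\<close> that is not heavy
  lies in the core, so the \<open>k\<close> lowest vertices of a component entered from it belong to
  the kernel.\<close>

lemma moves_iff_mac_moves: "(S, T) \<in> tok.moves\<^sup>* \<longleftrightarrow> (S, T) \<in> (tok.mac_moves U)\<^sup>*"
proof
  assume "(S, T) \<in> tok.moves\<^sup>*"
  then show "(S, T) \<in> (tok.mac_moves U)\<^sup>*"
  proof (rule tok.moves_imp_mac_moves[where H = H and k = k, rotated -1])
    show "H \<subseteq> A" if "good V E k A" for A using that unfolding good_def by blast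
    show "tok.cls v \<subseteq> U \<or> k \<le> card (U \<inter> tok.cls v)"
      if uv: "(u, v) \<in> F" "u \<notin> I" "u \<notin> H" "v \<in> I" for u v
    proof -
      have V: "u \<in> V" "v \<in> V" using uv F by auto
      have r: "u \<in> R" using uv V V_minus_idle by blast
      have "lowest k (tok.cls v) \<subseteq> U"
      proof
        fix w
        assume w: "w \<in> lowest k (tok.cls v)"
        then have vw: "(v, w) \<in> tok.conn" unfolding lowest_def by auto
        then have "w \<in> V" using tok.conn_V V by blast
        moreover have "v \<in> tok.cls w" using vw tok.conn_sym by blast
        moreover have "w \<in> lowest k (tok.cls w)" using w cls_eq[OF vw] by simp
        ultimately show "w \<in> U" using r uv(1) unfolding kernel_def by blast
      qed
      moreover have "card (lowest k (tok.cls v)) \<le> card (U \<inter> tok.cls v)" if "lowest k (tok.cls v) \<subseteq> U"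
        using that finite_cls[OF V(2)] by (intro card_mono) (auto simp: lowest_def)
      ultimately show ?thesis using lowest_cases[OF finite_cls[OF V(2)], of k] by fastforce
    qed
  qed (use kernel_facts S good_ST in auto)
qed (rule tok.mac_moves_imp_moves)

abbreviation "alliance \<equiv> global_offensive_alliance V E"

text \<open>Good sets and alliances coincide only up to size \<open>k\<close>. Moves preserve the
  size, so the bound on \<open>S\<close> is carried along and each of the four inclusions can be
  checked for single steps.\<close>

lemma swap_equiv:
  "(S, T) \<in> {(A, C). alliance A \<and> alliance C \<and> swap F A C}\<^sup>* \<longleftrightarrow>
   (S, T) \<in> {(A, C). A \<subseteq> U \<and> C \<subseteq> U \<and> alliance A \<and> card A \<le> k \<and> alliance C \<and> card C \<le> k \<and>
     swap tok.mac A C}\<^sup>*" (is "_ \<in> ?f\<^sup>* \<longleftrightarrow> _ \<in> ?m\<^sup>*")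
proof -
  have "(S, T) \<in> tok.moves\<^sup>*" if "(S, T) \<in> ?f\<^sup>*"
  proof (rule rtrancl_invariant[OF that, of "\<lambda>A. card A \<le> k", THEN conjunct2])
    show "card C \<le> k \<and> (A, C) \<in> tok.moves\<^sup>*" if "card A \<le> k" "(A, C) \<in> ?f" for A C
      using that swap_card[of F A C] alliance_good[of A] alliance_good[of C]
      unfolding tok.moves_def by (intro conjI r_into_rtrancl) auto
  qed (rule S(2))
  moreover have "(S, T) \<in> ?f\<^sup>*" if "(S, T) \<in> tok.moves\<^sup>*"
  proof (rule rtrancl_invariant[OF that, of "\<lambda>A. card A \<le> k", THEN conjunct2])
    show "card C \<le> k \<and> (A, C) \<in> ?f\<^sup>*" if "card A \<le> k" "(A, C) \<in> tok.moves" for A C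
      using that swap_card[of F A C] good_alliance[of A] good_alliance[of C]
      unfolding tok.moves_def by (intro conjI r_into_rtrancl) auto
  qed (rule S(2))
  moreover have "(S, T) \<in> (tok.mac_moves U)\<^sup>*" if "(S, T) \<in> ?m\<^sup>*"
  proof (rule rtrancl_invariant[OF that, of "\<lambda>A. card A \<le> k", THEN conjunct2])
    show "card C \<le> k \<and> (A, C) \<in> (tok.mac_moves U)\<^sup>*" if "card A \<le> k" "(A, C) \<in> ?m" for A C
      using that swap_card[of tok.mac A C] alliance_good[of A] alliance_good[of C]
      unfolding tok.mac_moves_def by (intro conjI r_into_rtrancl) auto
  qed (rule S(2))
  moreover have "(S, T) \<in> ?m\<^sup>*" if "(S, T) \<in> (tok.mac_moves U)\<^sup>*"
  proof (rule rtrancl_invariant[OF that, of "\<lambda>A. card A \<le> k", THEN conjunct2])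
    show "card C \<le> k \<and> (A, C) \<in> ?m\<^sup>*" if "card A \<le> k" "(A, C) \<in> (tok.mac_moves U)" for A C
      using that swap_card[of tok.mac A C] good_alliance[of A] good_alliance[of C]
      unfolding tok.mac_moves_def by (intro conjI r_into_rtrancl) auto
  qed (rule S(2))
  ultimately show ?thesis using moves_iff_mac_moves by blast
qed

section \<open>Addition and removal of tokens\<close>

definition tar :: "nat set rel" where
  "tar = {(A, C). alliance A \<and> card A \<le> k \<and> alliance C \<and> card C \<le> k \<and> reconf_step TAR E A C}"

definition tar_kernel :: "nat set rel" where
  "tar_kernel = {(A, C). A \<subseteq> U \<and> C \<subseteq> U \<and> (A, C) \<in> tar}"

lemma sym_tar_kernel: "sym (tar_kernel\<^sup>*)"
  by (rule sym_rtrancl) (auto simp: sym_def tar_kernel_def tar_def)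

lemma alliance_strip:
  assumes "alliance A" "card A \<le> k" "D \<subseteq> I"
  shows "alliance (A - D)" "card (A - D) \<le> k"
proof -
  have A: "A \<subseteq> V" using alliance_V assms(1) by auto
  then have "finite A" using finite_V by (rule finite_subset)
  show c: "card (A - D) \<le> k" using card_mono[of A "A - D"] \<open>finite A\<close> assms(2) by auto
  have "good V E k (A - D)"
    using assms A by (intro good_mono[OF alliance_good]) auto
  then show "alliance (A - D)" using c good_alliance by blast
qed

text \<open>Idle tokens are removed one at a time; the intermediate sets stay alliances by
  \<open>alliance_strip\<close>, and they only get smaller, so the threshold is respected.\<close>

lemma strip_idle:
  assumes "alliance A" "card A \<le> k" "A \<subseteq> U" "finite D" "D \<subseteq> I"
  shows "(A, A - D) \<in> tar_kernel\<^sup>*"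
  using assms(4,5)
proof (induction D rule: finite_induct)
  case (insert d D)
  have eq: "A - insert d D = (A - D) - {d}" by blast
  have "(A - D, A - insert d D) \<in> tar_kernel\<^sup>*"
  proof (cases "d \<in> A - D")
    case True
    then have "A - D = insert d (A - insert d D)" by blast
    then have "reconf_step TAR E (A - D) (A - insert d D)" by auto
    then have "(A - D, A - insert d D) \<in> tar_kernel"
      using alliance_strip[OF assms(1,2), of D] alliance_strip[OF assms(1,2), of "insert d D"]
        insert.prems assms(3) unfolding tar_kernel_def tar_def by auto
    then show ?thesis by blast
  next
    case False
    then have "A - insert d D = A - D" by blast
    then show ?thesis by simp
  qed
  then show ?case using insert.IH insert.prems by (auto intro: rtrancl_trans)
qed simp

text \<open>Each set \<open>A\<close> of a sequence is projected to \<open>A - I\<close>, which lies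
  in the kernel; a step at an idle vertex becomes stationary. The ends are joined by stripping
  \<open>S\<close> and by stripping \<open>T\<close> in reverse.\<close>

lemma tar_equiv: "(S, T) \<in> tar\<^sup>* \<longleftrightarrow> (S, T) \<in> tar_kernel\<^sup>*"
proof
  assume "(S, T) \<in> tar\<^sup>*"
  have "(S - I, A - I) \<in> tar_kernel\<^sup>*" if "(S, A) \<in> tar\<^sup>*" for A
    using that
  proof (induction rule: rtrancl_induct)
    case (step A C)
    have AC: "alliance A" "card A \<le> k" "alliance C" "card C \<le> k" "reconf_step TAR E A C"
      using step.hyps(2) unfolding tar_def by auto
    have "A - I \<subseteq> U" "C - I \<subseteq> U"
      using kernel_facts(4) alliance_V AC(1,3) by blast+
    moreover have "A - I = C - I \<or> reconf_step TAR E (A - I) (C - I)"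
      using AC(5) by (auto simp: insert_Diff_if)
    ultimately have "A - I = C - I \<or> (A - I, C - I) \<in> tar_kernel"
      using alliance_strip[OF AC(1,2), of I] alliance_strip[OF AC(3,4), of I]
      unfolding tar_kernel_def tar_def by blast
    then show ?case using step.IH by (auto intro: rtrancl.rtrancl_into_rtrancl)
  qed simp
  from this[OF \<open>(S, T) \<in> tar\<^sup>*\<close>] have "(S - I, T - I) \<in> tar_kernel\<^sup>*" .
  moreover have fI: "finite I" using finite_V unfolding idle_def by simp
  have "(S, S - I) \<in> tar_kernel\<^sup>*" "(T, T - I) \<in> tar_kernel\<^sup>*"
    using S T kernel_facts fI by (auto intro!: strip_idle)
  moreover have "(T - I, T) \<in> tar_kernel\<^sup>*"
    using sym_tar_kernel \<open>(T, T - I) \<in> _\<close> by (rule symD)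
  ultimately show "(S, T) \<in> tar_kernel\<^sup>*" by (meson rtrancl_trans)
next
  show "(S, T) \<in> tar_kernel\<^sup>* \<Longrightarrow> (S, T) \<in> tar\<^sup>*"
    by (rule rtrancl_mono[THEN subsetD]) (auto simp: tar_kernel_def)
qed

text \<open>\<open>Z\<close> represents all classes that have a neighbour in the core; each of them
  contributes at most \<open>k\<close> vertices, beside \<open>S\<close>, \<open>T\<close> and the
  core.\<close>

lemma card_kernel:
  assumes Z: "Z \<subseteq> V" "card Z \<le> m" "\<And>r v w. r \<in> R \<Longrightarrow> (r, w) \<in> F \<Longrightarrow> (v, w) \<in> tok.conn \<Longrightarrow> \<exists>z\<in>Z. (z, v) \<in> tok.conn"
  shows "card U \<le> k + k + 4 * k ^ 3 + m * k"
proof -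
  let ?W = "\<Union>z\<in>Z. lowest k (tok.cls z)"
  have "U \<subseteq> S \<union> T \<union> R \<union> ?W"
  proof
    fix v
    assume v: "v \<in> U"
    show "v \<in> S \<union> T \<union> R \<union> ?W"
    proof (rule ccontr)
      assume n: "v \<notin> S \<union> T \<union> R \<union> ?W"
      then obtain r w where rw: "r \<in> R" "(r, w) \<in> F" "(v, w) \<in> tok.conn" and l: "v \<in> lowest k (tok.cls v)"
        using v unfolding kernel_def by blast
      from Z(3)[OF rw] obtain z where "z \<in> Z" "(z, v) \<in> tok.conn" by blast
      then show False using l n cls_eq[of z v] by auto
    qed
  qed
  moreover have finZ: "finite Z" using Z(1) finite_V finite_subset by blast
  moreover have fl: "finite (lowest k (tok.cls z))" if "z \<in> Z" for z
    by (rule finite_subset[OF _ finite_cls[of z]]) (use that Z(1) in \<open>auto simp: lowest_def\<close>)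
  moreover have fin: "finite S" "finite T" "finite R"
    using alliance_finite S(1) T(1) finite_V unfolding core_def by auto
  ultimately have "card U \<le> card (S \<union> T \<union> R \<union> ?W)" by (intro card_mono) auto
  also have "\<dots> \<le> card S + card T + card R + card ?W"
    by (meson add_mono card_Un_le order_trans order_refl)
  also have "card ?W \<le> (\<Sum>z\<in>Z. card (lowest k (tok.cls z)))"
    using finZ by (rule card_UN_le)
  also have "\<dots> \<le> card Z * k"
    using sum_bounded_above[of Z "\<lambda>z. card (lowest k (tok.cls z))" k] finite_cls Z(1)
    by (auto intro!: card_lowest)
  also have "\<dots> \<le> m * k" using Z(2) by (rule mult_right_mono) simp
  finally show ?thesis
    using S(2) T(2) card_core[OF good_ST(1) S(2)] by linarith
qed

text \<open>Every class in question contains a neighbour of the core, so the core and its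
  neighbourhood serve as representatives.\<close>

lemma card_kernel_sliding:
  assumes "F = E"
  shows "card U \<le> k + k + 4 * k ^ 3 + (4 * k ^ 3 * (2 * k)) * k"
proof (rule card_kernel)
  let ?Z = "\<Union>v\<in>R. insert v (nbh E v)"
  show "?Z \<subseteq> V" using nbh_V unfolding core_def by auto
  show "card ?Z \<le> 4 * k ^ 3 * (2 * k)"
    using card_core[OF good_ST(1) S(2)] by (intro card_UN_closed_nbh) (auto simp: core_def)
  show "\<exists>z\<in>?Z. (z, v) \<in> tok.conn" if "r \<in> R" "(r, w) \<in> F" "(v, w) \<in> tok.conn" for r v w
    using that tok.conn_sym assms unfolding nbh_def by blast
qed

text \<open>In a complete relation all idle vertices form one class, and every other class is a
  single vertex of \<open>H\<close> or of the core.\<close>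

lemma card_kernel_jumping:
  assumes "F = V \<times> V"
  shows "card U \<le> k + k + 4 * k ^ 3 + (k + 4 * k ^ 3 + 1) * k"
proof -
  \<comment> \<open>A representative of the idle class, provided that there are idle
    vertices.\<close>
  let ?X = "if I = {} then {} else {SOME i. i \<in> I}"
  have X: "?X \<subseteq> I" "I \<noteq> {} \<Longrightarrow> ?X \<noteq> {}" "card ?X \<le> 1"
    by (auto intro: someI)
  have IV: "I \<subseteq> V" "H \<subseteq> V" "R \<subseteq> V" unfolding idle_def heavy_def core_def by auto
  have "card H \<le> k"
  proof -
    have "H \<subseteq> S" using good_ST unfolding good_def by auto
    then have "card H \<le> card S" using alliance_V[OF S(1)] finite_V by (intro card_mono) (auto dest: finite_subset)
    then show ?thesis using S(2) by simp
  qed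
  show ?thesis
  proof (rule card_kernel)
    show "H \<union> R \<union> ?X \<subseteq> V" using X IV by blast
    have "card (H \<union> R \<union> ?X) \<le> card H + card R + card ?X"
      by (meson add_mono card_Un_le order_trans order_refl)
    then show "card (H \<union> R \<union> ?X) \<le> k + 4 * k ^ 3 + 1"
      using card_core[OF good_ST(1) S(2)] X(3) \<open>card H \<le> k\<close> by linarith
    fix r v w
    assume "(r, w) \<in> F" "(v, w) \<in> tok.conn"
    then have v: "v \<in> V" using F tok.conn_V tok.conn_sym by blast
    show "\<exists>z\<in>H \<union> R \<union> ?X. (z, v) \<in> tok.conn"
    proof (cases "v \<in> I")
      case True
      then obtain i where i: "i \<in> ?X" "i \<in> I" using X by blast
      then have "(i, v) \<in> F \<inter> I \<times> I" using True IV assms by blast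
      then show ?thesis using i unfolding tok.conn_def by blast
    next
      case False
      then show ?thesis using v V_minus_idle tok.conn_refl by blast
    qed
  qed
qed

end

text \<open>The left side adds the representatives of sliding and of jumping, so that it covers all
  three rules. Each of its monomials is at most \<open>(k + 1) ^ 5\<close>, the coefficients sum to
  20, and \<open>20 \<le> 2 ^ 5\<close> and \<open>k + 1 \<le> 2 ^ k\<close> give the
  exponent.\<close>

lemma poly_le_exp: "k + k + 4 * k ^ 3 + (4 * k ^ 3 * (2 * k) + k + 4 * k ^ 3 + 1) * k \<le> 2 ^ (5 * k + 5)"
  for k :: nat
proof -
  let ?m = "k + 1"
  have "k \<le> ?m ^ 5" using power_increasing[of 1 5 ?m] by simp
  moreover have p: "k ^ i \<le> ?m ^ 5" if "i \<le> 5" for i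
    by (rule order_trans[OF power_mono power_increasing]) (use that in auto)
  have "k ^ 2 \<le> ?m ^ 5" "k ^ 3 \<le> ?m ^ 5" "k ^ 4 \<le> ?m ^ 5" "k ^ 5 \<le> ?m ^ 5"
    by (rule p; simp)+
  moreover have "k + k + 4 * k ^ 3 + (4 * k ^ 3 * (2 * k) + k + 4 * k ^ 3 + 1) * k =
      3 * k + 4 * k ^ 3 + 8 * k ^ 5 + k ^ 2 + 4 * k ^ 4"
    by (simp add: eval_nat_numeral algebra_simps)
  ultimately have "k + k + 4 * k ^ 3 + (4 * k ^ 3 * (2 * k) + k + 4 * k ^ 3 + 1) * k \<le> 32 * ?m ^ 5"
    by linarith
  also have "?m ^ 5 \<le> (2 ^ k) ^ 5"
    using less_exp[of k] by (intro power_mono) (auto simp: Suc_le_eq)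
  finally show ?thesis
    by (simp add: power_add mult.commute flip: power_mult)
qed

subsection \<open>The decision procedure\<close>

definition pairs :: "'a list \<Rightarrow> ('a \<times> 'a) list" where
  "pairs xs = concat (map (\<lambda>a. map (Pair a) xs) xs)"

lemma set_pairs [simp]: "set (pairs xs) = set xs \<times> set xs"
  unfolding pairs_def by auto

lemma polytime_pairs [polytime_intros]:
  assumes "polytime xs"
  shows "polytime (\<lambda>x. pairs (xs x))"
  unfolding pairs_def by (intro polytime_intros polytime_comp[OF assms] assms)

definition same_set :: "'a list \<Rightarrow> 'a list \<Rightarrow> bool" where
  "same_set xs ys \<longleftrightarrow> (\<forall>x\<in>set xs. x \<in> set ys) \<and> (\<forall>y\<in>set ys. y \<in> set xs)"

lemma same_set_iff: "same_set xs ys \<longleftrightarrow> set xs = set ys"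
  unfolding same_set_def by auto

lemma polytime_same_set [polytime_intros]:
  assumes "polytime xs" "polytime ys"
  shows "polytime (\<lambda>x. same_set (xs x) (ys x))"
  unfolding same_set_def by (intro polytime_intros polytime_comp[OF assms(1)] polytime_comp[OF assms(2)] assms)

text \<open>Filtering the ground list, instead of appending to \<open>X\<close>, keeps the result
  bounded in size and free of repetitions if the ground list is.\<close>

definition expand :: "'a list \<Rightarrow> ('a \<times> 'a) list \<Rightarrow> 'a list \<Rightarrow> 'a list" where
  "expand ground R X = filter (\<lambda>b. b \<in> set X \<or> (\<exists>a\<in>set X. (a, b) \<in> set R)) ground"

text \<open>The list \<open>R\<close> also serves as a counter: a reachable element is reached
  within as many steps as \<open>R\<close> has pairs.\<close>

definition reachable :: "'a list \<Rightarrow> ('a \<times> 'a) list \<Rightarrow> 'a \<Rightarrow> 'a list" where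
  "reachable ground R a = fold (\<lambda>_. expand ground R) R [a]"

lemma fold_expand:
  assumes "set R \<subseteq> set ground \<times> set ground" "a \<in> set ground"
  shows "set (fold (\<lambda>_. expand ground R) l [a]) = {b. \<exists>m\<le>length l. (a, b) \<in> set R ^^ m}"
proof (induction l rule: rev_induct)
  case Nil
  then show ?case by auto
next
  case (snoc y l)
  let ?S = "{b. \<exists>m\<le>length l. (a, b) \<in> set R ^^ m}"
  have "?S \<subseteq> set ground"
  proof
    fix b
    assume "b \<in> ?S"
    then obtain m where "(a, b) \<in> set R ^^ m" by blast
    then show "b \<in> set ground" using assms by (cases m) auto
  qed
  then have "set (fold (\<lambda>_. expand ground R) (l @ [y]) [a]) = ?S \<union> set R `` ?S"
    using assms(1) snoc.IH unfolding expand_def by auto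
  also have "\<dots> = {b. \<exists>m\<le>length (l @ [y]). (a, b) \<in> set R ^^ m}"
  proof (intro equalityI subsetI)
    fix b
    assume "b \<in> ?S \<union> set R `` ?S"
    then show "b \<in> {b. \<exists>m\<le>length (l @ [y]). (a, b) \<in> set R ^^ m}"
    proof
      assume "b \<in> set R `` ?S"
      then obtain c m where "m \<le> length l" "(a, c) \<in> set R ^^ m" "(c, b) \<in> set R" by blast
      then have "(a, b) \<in> set R ^^ Suc m" "Suc m \<le> length (l @ [y])" by auto
      then show ?thesis by blast
    qed (auto intro: le_SucI)
  next
    fix b
    assume "b \<in> {b. \<exists>m\<le>length (l @ [y]). (a, b) \<in> set R ^^ m}"
    then obtain m where m: "m \<le> Suc (length l)" "(a, b) \<in> set R ^^ m" by auto
    show "b \<in> ?S \<union> set R `` ?S"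
    proof (cases "m \<le> length l")
      case False
      then have "m = Suc (length l)" using m by simp
      then obtain c where "(a, c) \<in> set R ^^ length l" "(c, b) \<in> set R" using m by auto
      then show ?thesis by blast
    qed (use m in blast)
  qed
  finally show ?case .
qed

lemma set_reachable:
  assumes "set R \<subseteq> set ground \<times> set ground" "a \<in> set ground"
  shows "set (reachable ground R a) = (set R)\<^sup>* `` {a}"
proof -
  have "(set R)\<^sup>* = (\<Union>m\<in>{m. m \<le> card (set R)}. set R ^^ m)"
    by (rule rtrancl_finite_eq_relpow) simp
  then have "(set R)\<^sup>* `` {a} \<subseteq> {b. \<exists>m\<le>length R. (a, b) \<in> set R ^^ m}"
    using card_length[of R] by (auto intro: order_trans)
  moreover have "{b. \<exists>m\<le>length R. (a, b) \<in> set R ^^ m} \<subseteq> (set R)\<^sup>* `` {a}"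
    using relpow_imp_rtrancl by fastforce
  ultimately show ?thesis
    unfolding reachable_def fold_expand[OF assms] by blast
qed

text \<open>Ranks inside a class are computed as list lengths, which is correct only without
  repetitions.\<close>

lemma distinct_reachable:
  assumes "distinct ground"
  shows "distinct (reachable ground R a)"
proof -
  have "distinct (fold (\<lambda>_. expand ground R) l [a])" for l
    by (induction l rule: rev_induct) (auto simp: expand_def assms)
  then show ?thesis unfolding reachable_def .
qed

lemma polytime_expand [polytime_intros]:
  assumes "polytime ground" "polytime R" "polytime X"
  shows "polytime (\<lambda>x. expand (ground x) (R x) (X x))"
  unfolding expand_def
  by (intro polytime_intros polytime_comp[OF assms(1)] polytime_comp[OF assms(2)]
      polytime_comp[OF assms(3)] assms)

lemma polytime_reachable [polytime_intros]:
  assumes "polytime ground" "polytime R" "polytime a"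
  shows "polytime (\<lambda>x. reachable (ground x) (R x) (a x))"
proof -
  \<comment> \<open>After at least one round the state is a filtered copy of the ground list; before
    that it is \<open>[a x]\<close>.\<close>
  have "esize (fold (\<lambda>_. expand (ground x) (R x)) l [a x]) \<le> esize (ground x) + esize (a x) + 1" for x l
  proof (cases l rule: rev_cases)
    case (snoc ys y)
    then show ?thesis
      unfolding snoc fold_append comp_apply fold_simps expand_def
      by (intro order_trans[OF esize_filter]) simp
  qed simp
  then show ?thesis unfolding reachable_def
    by (intro polytime_fold[where B = "\<lambda>x. esize (ground x) + esize (a x) + 1"] polytime_intros
        polytime_comp[OF assms(1)] polytime_comp[OF assms(2)] assms poly_bounded_intros polytimeD)
qed

text \<open>
  The number of sublists is cut off at \<open>M\<close> so that enumerating them takes polynomial time.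
\<close>

definition sublists_upto :: "nat \<Rightarrow> 'a list \<Rightarrow> 'a list list" where
  "sublists_upto M U = fold (\<lambda>u acc. take M (map ((#) u) acc @ acc)) U [[]]"

lemma sublists_upto_snoc:
  "sublists_upto M (U @ [u]) = take M (map ((#) u) (sublists_upto M U) @ sublists_upto M U)"
  unfolding sublists_upto_def by simp

lemma sublists_upto_subset: "A \<in> set (sublists_upto M U) \<Longrightarrow> set A \<subseteq> set U"
proof (induction U arbitrary: A rule: rev_induct)
  case Nil
  then show ?case by (simp add: sublists_upto_def)
next
  case (snoc u U)
  then show ?case unfolding sublists_upto_snoc by (fastforce dest!: in_set_takeD)
qed

text \<open>The exact length belongs to the induction: it shows that the cut-off never takes
  effect.\<close>

lemma sublists_upto_complete:
  assumes "2 ^ length U \<le> M"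
  shows "length (sublists_upto M U) = 2 ^ length U \<and> Pow (set U) \<subseteq> set ` set (sublists_upto M U)"
  using assms
proof (induction U rule: rev_induct)
  case Nil
  then show ?case by (simp add: sublists_upto_def)
next
  case (snoc u U)
  let ?L = "sublists_upto M U"
  have IH: "length ?L = 2 ^ length U" "Pow (set U) \<subseteq> set ` set ?L"
    using snoc by auto
  have eq: "sublists_upto M (U @ [u]) = map ((#) u) ?L @ ?L"
    using snoc.prems IH(1) unfolding sublists_upto_snoc by simp
  have "X \<in> set ` set (sublists_upto M (U @ [u]))" if X: "X \<subseteq> set (U @ [u])" for X
  proof (cases "u \<in> X")
    case True
    have "X - {u} \<in> set ` set ?L" using IH(2) X by auto
    then obtain A where "A \<in> set ?L" "set A = X - {u}" by blast
    then have "u # A \<in> set (sublists_upto M (U @ [u]))" "set (u # A) = X"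
      using True unfolding eq by auto
    then show ?thesis by (metis image_eqI)
  next
    case False
    then have "X \<in> set ` set ?L" using IH(2) X by auto
    then show ?thesis unfolding eq by auto
  qed
  then show ?case using IH(1) unfolding eq by auto
qed

lemma polytime_sublists_upto [polytime_intros]:
  assumes "polytime M" "polytime U"
  shows "polytime (\<lambda>x. sublists_upto (M x) (U x))"
proof -
  have elem: "\<forall>A\<in>set (sublists_upto m us). esize A \<le> esize us" for m and us :: "'b list"
  proof (induction us rule: rev_induct)
    case Nil
    then show ?case by (simp add: sublists_upto_def)
  next
    case (snoc u us)
    then show ?case unfolding sublists_upto_snoc by (fastforce dest!: in_set_takeD)
  qed
  \<comment> \<open>The initial list \<open>[[]]\<close> is not cut off and has length 1 even for
    \<open>m = 0\<close>.\<close>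
  have len: "length (sublists_upto m us) \<le> m + 1" for m and us :: "'b list"
    by (cases us rule: rev_cases) (auto simp: sublists_upto_snoc, simp add: sublists_upto_def)
  let ?B = "\<lambda>x. (M x + 1) * (esize (U x) + 1)"
  have "esize (sublists_upto (M x) us) \<le> ?B x" if "U x = us @ vs" for x us vs
  proof -
    have "esize (sublists_upto (M x) us) = esize (map (\<lambda>A. A) (sublists_upto (M x) us))" by simp
    also have "\<dots> \<le> length (sublists_upto (M x) us) * (esize us + 1)"
      using elem by (intro esize_map) blast
    also have "\<dots> \<le> ?B x"
      using len that by (intro mult_mono) auto
    finally show ?thesis .
  qed
  then show ?thesis
    unfolding sublists_upto_def
    by (intro polytime_fold[where B = ?B] polytime_intros polytime_comp[OF assms(1)] assms
        poly_bounded_intros polytimeD polytimeD[OF assms(1), unfolded esize_nat])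
qed

section \<open>Decoding instances\<close>

definition bit :: "bool list \<Rightarrow> nat \<Rightarrow> bool" where
  "bit x i \<longleftrightarrow> take 1 (drop i x) = [True]"

text \<open>Positions beyond the end read as false, so decoding is total even on strings that encode
  nothing.\<close>

lemma bit_iff: "bit x i \<longleftrightarrow> i < length x \<and> x ! i"
  unfolding bit_def by (cases "i < length x") (auto simp: take_Suc_conv_app_nth hd_drop_conv_nth take_Suc)

lemma polytime_bit [polytime_intros]:
  assumes "polytime f" "polytime g"
  shows "polytime (\<lambda>x. bit (f x) (g x))"
  unfolding bit_def by (intro polytime_intros assms)

definition decode_edges :: "nat \<Rightarrow> bool list \<Rightarrow> (nat \<times> nat) list" where
  "decode_edges n x = filter (\<lambda>p. bit x (n + 1 + fst p * n + snd p)) (pairs [0..<n])"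

text \<open>The offset skips the unary header, its terminator and the matrix; \<open>j = 0\<close>
  reads the start set and \<open>j = 1\<close> the target set.\<close>

definition decode_set :: "nat \<Rightarrow> nat \<Rightarrow> bool list \<Rightarrow> nat list" where
  "decode_set n j x = filter (\<lambda>i. bit x (n + 1 + n * n + j * n + i)) [0..<n]"

lemma polytime_decode [polytime_intros]:
  assumes "polytime n" "polytime f"
  shows "polytime (\<lambda>x. decode_edges (n x) (f x))" "polytime (\<lambda>x. decode_set (n x) j (f x))"
  unfolding decode_edges_def decode_set_def
  by (intro polytime_intros polytime_comp[OF assms(1)] polytime_comp[OF assms(2)] assms)+

lemma nth_concat_uniform:
  assumes "\<forall>r\<in>set rs. length r = n" "i < length rs" "j < n"
  shows "concat rs ! (i * n + j) = rs ! i ! j"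
  using assms
proof (induction rs arbitrary: i)
  case (Cons r rs)
  then show ?case by (cases i) (auto simp: nth_append)
qed simp

lemma length_concat_uniform: "\<forall>r\<in>set rs. length r = n \<Longrightarrow> length (concat rs) = length rs * n"
  by (induction rs) auto

lemma length_encode: "length (encode n E S T) = n + 1 + n * n + n + n"
  unfolding encode_def by (simp add: length_concat_uniform[of _ n])

lemma decode_encode:
  assumes "E \<subseteq> {..<n} \<times> {..<n}" "S \<subseteq> {..<n}" "T \<subseteq> {..<n}"
  shows "set (decode_edges n (encode n E S T)) = E" "set (decode_set n 0 (encode n E S T)) = S"
    "set (decode_set n 1 (encode n E S T)) = T"
proof -
  let ?x = "encode n E S T"
  let ?rows = "map (\<lambda>i. map (\<lambda>j. (i, j) \<in> E) [0..<n]) [0..<n]"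
  have len: "length (concat ?rows) = n * n"
    by (simp add: length_concat_uniform[of _ n])
  have x: "?x = (replicate n True @ [False]) @ concat ?rows @ map (\<lambda>i. i \<in> S) [0..<n] @ map (\<lambda>i. i \<in> T) [0..<n]"
    unfolding encode_def by simp
  have E: "bit ?x (n + 1 + i * n + j) \<longleftrightarrow> (i, j) \<in> E" if ij: "i < n" "j < n" for i j
  proof -
    have "i * n + j < Suc i * n" using ij by simp
    also have "\<dots> \<le> n * n" using ij by (intro mult_right_mono) auto
    finally have lt: "i * n + j < n * n" .
    have "?x ! (n + 1 + i * n + j) = ?x ! (length (replicate n True @ [False]) + (i * n + j))"
      by (simp add: add.assoc)
    also have "\<dots> = concat ?rows ! (i * n + j)"
      unfolding x nth_append_length_plus using lt len by (simp add: nth_append)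
    also have "\<dots> = ((i, j) \<in> E)"
      using ij by (subst nth_concat_uniform) auto
    finally show ?thesis using lt unfolding bit_iff length_encode by simp
  qed
  then show "set (decode_edges n ?x) = E"
    using assms(1) unfolding decode_edges_def by force
  have S: "bit ?x (n + 1 + n * n + 0 * n + i) \<longleftrightarrow> i \<in> S" if "i < n" for i
  proof -
    have "?x ! (n + 1 + n * n + 0 * n + i) = ?x ! (length (replicate n True @ [False]) + (length (concat ?rows) + i))"
      unfolding len by (simp add: add.assoc)
    also have "\<dots> = (i \<in> S)"
      unfolding x nth_append_length_plus using that by (simp add: nth_append)
    finally show ?thesis using that unfolding bit_iff length_encode by simp
  qed
  then show "set (decode_set n 0 ?x) = S"
    using assms(2) unfolding decode_set_def by auto
  have T: "bit ?x (n + 1 + n * n + 1 * n + i) \<longleftrightarrow> i \<in> T" if "i < n" for i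
  proof -
    have "?x ! (n + 1 + n * n + 1 * n + i) = ?x ! (length (replicate n True @ [False]) +
        (length (concat ?rows) + (length (map (\<lambda>i. i \<in> S) [0..<n]) + i)))"
      unfolding len by (simp add: add.assoc)
    also have "\<dots> = (i \<in> T)"
      unfolding x nth_append_length_plus using that by simp
    finally show ?thesis using that unfolding bit_iff length_encode by simp
  qed
  then show "set (decode_set n 1 ?x) = T"
    using assms(3) unfolding decode_set_def by auto
qed

lemma polytime_encode [polytime_intros]:
  assumes "polytime n" "polytime E" "polytime S" "polytime T"
  shows "polytime (\<lambda>x. encode (n x) (set (E x)) (set (S x)) (set (T x)))"
  unfolding encode_def
  by (intro polytime_intros polytime_comp[OF assms(1)] polytime_comp[OF assms(2)]
      polytime_comp[OF assms(3)] polytime_comp[OF assms(4)] assms)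

section \<open>The procedure on lists\<close>

definition degree_list :: "nat \<Rightarrow> (nat \<times> nat) list \<Rightarrow> nat list \<Rightarrow> nat \<Rightarrow> nat" where
  "degree_list n E A v = length (filter (\<lambda>u. (v, u) \<in> set E \<and> u \<in> set A) [0..<n])"

definition card_list :: "nat \<Rightarrow> nat list \<Rightarrow> nat" where
  "card_list n A = length (filter (\<lambda>v. v \<in> set A) [0..<n])"

definition alliance_list :: "nat \<Rightarrow> (nat \<times> nat) list \<Rightarrow> nat list \<Rightarrow> bool" where
  "alliance_list n E A \<longleftrightarrow> (\<forall>v\<in>set A. v < n) \<and>
    (\<forall>v\<in>set [0..<n]. v \<in> set A \<or> degree_list n E [0..<n] v < 2 * degree_list n E A v)"

definition heavy_list :: "nat \<Rightarrow> nat \<Rightarrow> (nat \<times> nat) list \<Rightarrow> nat list" where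
  "heavy_list n k E = filter (\<lambda>v. 2 * k \<le> degree_list n E [0..<n] v) [0..<n]"

definition bad_list :: "nat \<Rightarrow> nat \<Rightarrow> (nat \<times> nat) list \<Rightarrow> nat list" where
  "bad_list n k E = filter (\<lambda>v. v \<notin> set (heavy_list n k E) \<and>
    2 * degree_list n E (heavy_list n k E) v \<le> degree_list n E [0..<n] v) [0..<n]"

definition core_list :: "nat \<Rightarrow> nat \<Rightarrow> (nat \<times> nat) list \<Rightarrow> nat list" where
  "core_list n k E = filter (\<lambda>v. v \<notin> set (heavy_list n k E) \<and>
    (v \<in> set (bad_list n k E) \<or> (\<exists>b\<in>set (bad_list n k E). (v, b) \<in> set E))) [0..<n]"

definition idle_list :: "nat \<Rightarrow> nat \<Rightarrow> (nat \<times> nat) list \<Rightarrow> nat list" where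
  "idle_list n k E = filter (\<lambda>v. v \<notin> set (heavy_list n k E) \<and> v \<notin> set (core_list n k E)) [0..<n]"

definition class_list :: "nat \<Rightarrow> nat \<Rightarrow> (nat \<times> nat) list \<Rightarrow> (nat \<times> nat) list \<Rightarrow> nat \<Rightarrow> nat list" where
  "class_list n k E F v = reachable [0..<n]
     (filter (\<lambda>p. fst p \<in> set (idle_list n k E) \<and> snd p \<in> set (idle_list n k E)) F) v"

definition kernel_list ::
    "nat \<Rightarrow> nat \<Rightarrow> (nat \<times> nat) list \<Rightarrow> (nat \<times> nat) list \<Rightarrow> nat list \<Rightarrow> nat list \<Rightarrow> nat list" where
  "kernel_list n k E F S T = filter (\<lambda>v. v \<in> set S \<or> v \<in> set T \<or> v \<in> set (core_list n k E) \<or>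
     (\<exists>w\<in>set (class_list n k E F v). \<exists>r\<in>set (core_list n k E). (r, w) \<in> set F) \<and>
     length (filter (\<lambda>w. w < v) (class_list n k E F v)) < k) [0..<n]"

definition mac_list :: "nat \<Rightarrow> nat \<Rightarrow> (nat \<times> nat) list \<Rightarrow> (nat \<times> nat) list \<Rightarrow> nat \<Rightarrow> nat \<Rightarrow> bool" where
  "mac_list n k E F u v \<longleftrightarrow> (\<exists>a\<in>set (class_list n k E F u). \<exists>b\<in>set (class_list n k E F v).
     a = b \<or> (a, b) \<in> set F)"

definition insert_list :: "nat \<Rightarrow> nat list \<Rightarrow> nat list \<Rightarrow> bool" where
  "insert_list n A C \<longleftrightarrow> (\<exists>v\<in>set [0..<n]. v \<notin> set A \<and> same_set C (v # A))"

definition step_list :: "reconf_rule \<Rightarrow> nat \<Rightarrow> nat \<Rightarrow> (nat \<times> nat) list \<Rightarrow> (nat \<times> nat) list \<Rightarrow>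
    nat list \<Rightarrow> nat list \<Rightarrow> bool" where
  "step_list Y n k E F A C \<longleftrightarrow> (if Y = TAR then insert_list n A C \<or> insert_list n C A
     else \<exists>u\<in>set A. \<exists>v\<in>set [0..<n]. v \<notin> set A \<and> mac_list n k E F u v \<and>
       same_set C (v # filter (\<lambda>w. w \<noteq> u) A))"

definition states_list :: "nat \<Rightarrow> nat \<Rightarrow> nat \<Rightarrow> (nat \<times> nat) list \<Rightarrow> nat list \<Rightarrow> nat list list" where
  "states_list M n k E U = filter (\<lambda>A. alliance_list n E A \<and> card_list n A \<le> k) (sublists_upto M U)"

definition link_list :: "reconf_rule \<Rightarrow> nat \<Rightarrow> (nat \<times> nat) list \<Rightarrow> (nat \<times> nat) list" where
  "link_list Y n E = (if Y = TS then E else pairs [0..<n])"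

text \<open>Start and target are located among the enumerated states by their elements, since the
  enumeration orders its lists in its own way.\<close>

definition search_list :: "('a list \<times> 'a list) list \<Rightarrow> 'a list list \<Rightarrow> 'a list \<Rightarrow> 'a list \<Rightarrow> bool" where
  "search_list R st S T \<longleftrightarrow> (\<exists>A\<in>set st. same_set A S \<and> (\<exists>C\<in>set (reachable st R A). same_set C T))"

definition reconf_list :: "reconf_rule \<Rightarrow> nat \<Rightarrow> nat \<Rightarrow> nat \<Rightarrow> (nat \<times> nat) list \<Rightarrow> (nat \<times> nat) list \<Rightarrow>
    nat list list \<Rightarrow> nat list \<Rightarrow> nat list \<Rightarrow> bool" where
  "reconf_list Y M n k E F st S T \<longleftrightarrow>
     search_list (filter (\<lambda>p. step_list Y n k E F (fst p) (snd p)) (pairs st)) st S T"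

definition simple_list :: "nat \<Rightarrow> (nat \<times> nat) list \<Rightarrow> bool" where
  "simple_list n E \<longleftrightarrow>
     (\<forall>p\<in>set E. fst p < n \<and> snd p < n \<and> fst p \<noteq> snd p \<and> (snd p, fst p) \<in> set E)"

definition solves_list :: "reconf_rule \<Rightarrow> nat \<Rightarrow> nat \<Rightarrow> nat \<Rightarrow> (nat \<times> nat) list \<Rightarrow>
    nat list \<Rightarrow> nat list \<Rightarrow> bool" where
  "solves_list Y M n k E S T \<longleftrightarrow> simple_list n E \<and> alliance_list n E S \<and> alliance_list n E T \<and>
     (Y \<noteq> TAR \<longrightarrow> card_list n S = k \<and> card_list n T = k) \<and>
     reconf_list Y M n k E (link_list Y n E)
       (states_list M n k E (kernel_list n k E (link_list Y n E) S T)) S T"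

text \<open>All candidates for \<open>n\<close> are tried, and well-formedness is tested by
  decoding, encoding again and comparing with the input.\<close>

definition decide :: "reconf_rule \<Rightarrow> bool list \<times> nat \<times> nat \<Rightarrow> bool" where
  "decide Y p \<longleftrightarrow> (\<exists>n\<in>set [0..<Suc (length (fst p))].
     fst p = encode n (set (decode_edges n (fst p))) (set (decode_set n 0 (fst p)))
       (set (decode_set n 1 (fst p))) \<and>
     solves_list Y (snd (snd p)) n (fst (snd p)) (decode_edges n (fst p)) (decode_set n 0 (fst p))
       (decode_set n 1 (fst p)))"

section \<open>Running time of the procedure\<close>

lemma polytime_degree_list [polytime_intros]:
  assumes "polytime n" "polytime E" "polytime A" "polytime v"
  shows "polytime (\<lambda>x. degree_list (n x) (E x) (A x) (v x))"
  unfolding degree_list_def by (intro polytime_intros assms assms[THEN polytime_comp])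

lemma polytime_card_list [polytime_intros]:
  assumes "polytime n" "polytime A"
  shows "polytime (\<lambda>x. card_list (n x) (A x))"
  unfolding card_list_def by (intro polytime_intros assms assms[THEN polytime_comp])

lemma polytime_alliance_list [polytime_intros]:
  assumes "polytime n" "polytime E" "polytime A"
  shows "polytime (\<lambda>x. alliance_list (n x) (E x) (A x))"
  unfolding alliance_list_def by (intro polytime_intros assms assms[THEN polytime_comp])

lemma polytime_heavy_list [polytime_intros]:
  assumes "polytime n" "polytime k" "polytime E"
  shows "polytime (\<lambda>x. heavy_list (n x) (k x) (E x))"
  unfolding heavy_list_def by (intro polytime_intros assms assms[THEN polytime_comp])

lemma polytime_bad_list [polytime_intros]:
  assumes "polytime n" "polytime k" "polytime E"
  shows "polytime (\<lambda>x. bad_list (n x) (k x) (E x))"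
  unfolding bad_list_def by (intro polytime_intros assms assms[THEN polytime_comp])

lemma polytime_core_list [polytime_intros]:
  assumes "polytime n" "polytime k" "polytime E"
  shows "polytime (\<lambda>x. core_list (n x) (k x) (E x))"
  unfolding core_list_def by (intro polytime_intros assms assms[THEN polytime_comp])

lemma polytime_idle_list [polytime_intros]:
  assumes "polytime n" "polytime k" "polytime E"
  shows "polytime (\<lambda>x. idle_list (n x) (k x) (E x))"
  unfolding idle_list_def by (intro polytime_intros assms assms[THEN polytime_comp])

lemma polytime_class_list [polytime_intros]:
  assumes "polytime n" "polytime k" "polytime E" "polytime F" "polytime v"
  shows "polytime (\<lambda>x. class_list (n x) (k x) (E x) (F x) (v x))"
  unfolding class_list_def by (intro polytime_intros assms assms[THEN polytime_comp])

lemma polytime_kernel_list [polytime_intros]: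
  assumes "polytime n" "polytime k" "polytime E" "polytime F" "polytime S" "polytime T"
  shows "polytime (\<lambda>x. kernel_list (n x) (k x) (E x) (F x) (S x) (T x))"
  unfolding kernel_list_def by (intro polytime_intros assms assms[THEN polytime_comp])

lemma polytime_mac_list [polytime_intros]:
  assumes "polytime n" "polytime k" "polytime E" "polytime F" "polytime u" "polytime v"
  shows "polytime (\<lambda>x. mac_list (n x) (k x) (E x) (F x) (u x) (v x))"
  unfolding mac_list_def by (intro polytime_intros assms assms[THEN polytime_comp])

lemma polytime_insert_list [polytime_intros]:
  assumes "polytime n" "polytime A" "polytime C"
  shows "polytime (\<lambda>x. insert_list (n x) (A x) (C x))"
  unfolding insert_list_def by (intro polytime_intros assms assms[THEN polytime_comp])

lemma polytime_step_list [polytime_intros]: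
  assumes "polytime n" "polytime k" "polytime E" "polytime F" "polytime A" "polytime C"
  shows "polytime (\<lambda>x. step_list Y (n x) (k x) (E x) (F x) (A x) (C x))"
  unfolding step_list_def by (intro polytime_intros assms assms[THEN polytime_comp])

lemma polytime_states_list [polytime_intros]:
  assumes "polytime M" "polytime n" "polytime k" "polytime E" "polytime U"
  shows "polytime (\<lambda>x. states_list (M x) (n x) (k x) (E x) (U x))"
  unfolding states_list_def by (intro polytime_intros assms assms[THEN polytime_comp])

lemma polytime_link_list [polytime_intros]:
  assumes "polytime n" "polytime E"
  shows "polytime (\<lambda>x. link_list Y (n x) (E x))"
  unfolding link_list_def by (intro polytime_intros assms assms[THEN polytime_comp])

lemma polytime_search_list [polytime_intros]:
  assumes "polytime R" "polytime st" "polytime S" "polytime T"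
  shows "polytime (\<lambda>x. search_list (R x) (st x) (S x) (T x))"
  unfolding search_list_def by (intro polytime_intros assms assms[THEN polytime_comp])

lemma polytime_reconf_list [polytime_intros]:
  assumes "polytime M" "polytime n" "polytime k" "polytime E" "polytime F" "polytime st" "polytime S" "polytime T"
  shows "polytime (\<lambda>x. reconf_list Y (M x) (n x) (k x) (E x) (F x) (st x) (S x) (T x))"
  unfolding reconf_list_def by (intro polytime_intros assms assms[THEN polytime_comp])

lemma polytime_simple_list [polytime_intros]:
  assumes "polytime n" "polytime E"
  shows "polytime (\<lambda>x. simple_list (n x) (E x))"
  unfolding simple_list_def by (intro polytime_intros assms assms[THEN polytime_comp])

lemma polytime_solves_list [polytime_intros]:
  assumes "polytime M" "polytime n" "polytime k" "polytime E" "polytime S" "polytime T"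
  shows "polytime (\<lambda>x. solves_list Y (M x) (n x) (k x) (E x) (S x) (T x))"
  unfolding solves_list_def by (intro polytime_intros assms assms[THEN polytime_comp])

lemma polytime_decide: "polytime (decide Y)"
  unfolding decide_def[abs_def] by (intro polytime_intros)

section \<open>Correctness of the procedure\<close>

lemma length_filter_distinct: "distinct xs \<Longrightarrow> length (filter P xs) = card {x \<in> set xs. P x}"
  by (metis distinct_card distinct_filter set_filter)

lemma simple_list_iff: "simple_list n E \<longleftrightarrow> simple_graph {..<n} (set E)"
  unfolding simple_list_def simple_graph_def by (auto simp: sym_def irrefl_def)

lemma degree_list_eq:
  assumes "set A \<subseteq> {..<n}"
  shows "degree_list n E A v = degree_in (set E) (set A) v"
proof -
  have "{u \<in> set [0..<n]. (v, u) \<in> set E \<and> u \<in> set A} = nbh (set E) v \<inter> set A"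
    using assms unfolding nbh_def by auto
  then show ?thesis unfolding degree_list_def degree_in_def by (simp add: length_filter_distinct)
qed

lemma degree_list_upt [simp]: "degree_list n E [0..<n] v = degree_in (set E) {..<n} v"
  by (subst degree_list_eq) (auto simp: lessThan_atLeast0)

lemma card_list_eq: "set A \<subseteq> {..<n} \<Longrightarrow> card_list n A = card (set A)"
  unfolding card_list_def by (auto simp: length_filter_distinct intro!: arg_cong[of _ _ card])

lemma alliance_card_list: "alliance_list n E A \<Longrightarrow> card_list n A = card (set A)"
  by (rule card_list_eq) (auto simp: alliance_list_def)

lemma alliance_list_iff:
  assumes "simple_graph {..<n} (set E)"
  shows "alliance_list n E A \<longleftrightarrow> global_offensive_alliance {..<n} (set E) (set A)"
proof (cases "set A \<subseteq> {..<n}")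
  case True
  then show ?thesis
    unfolding alliance_list_def global_offensive_alliance_iff[OF assms]
    by (auto simp: degree_list_eq)
next
  case False
  then show ?thesis
    unfolding alliance_list_def global_offensive_alliance_iff[OF assms] by auto
qed

lemma set_heavy_list: "set (heavy_list n k E) = heavy {..<n} (set E) k"
  unfolding heavy_list_def heavy_def by auto

lemma set_bad_list: "set (bad_list n k E) = bad {..<n} (set E) k"
proof -
  have "set (heavy_list n k E) \<subseteq> {..<n}" unfolding heavy_list_def by auto
  then show ?thesis
    unfolding bad_list_def bad_def by (auto simp: degree_list_eq set_heavy_list)
qed

lemma set_core_list: "set (core_list n k E) = core {..<n} (set E) k"
  unfolding core_list_def core_def by (auto simp: set_heavy_list set_bad_list)

lemma set_idle_list: "set (idle_list n k E) = idle {..<n} (set E) k"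
  unfolding idle_list_def idle_def by (auto simp: set_heavy_list set_core_list)

text \<open>Steps depend on the underlying sets only, and every admissible set is represented by
  some state, so paths of sets lift to paths of lists from any representative.\<close>

lemma search_list_iff:
  assumes st: "set ` set st = {X. X \<subseteq> U \<and> P X}"
    and R: "\<And>A C. A \<in> set st \<Longrightarrow> C \<in> set st \<Longrightarrow> (A, C) \<in> set R \<longleftrightarrow> step (set A) (set C)"
    and sub: "set R \<subseteq> set st \<times> set st"
    and S: "set S \<subseteq> U" "P (set S)"
  shows "search_list R st S T \<longleftrightarrow>
    (set S, set T) \<in> {(X, Z). X \<subseteq> U \<and> Z \<subseteq> U \<and> P X \<and> P Z \<and> step X Z}\<^sup>*" (is "_ \<longleftrightarrow> _ \<in> ?K\<^sup>*")
proof
  assume "search_list R st S T"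
  then obtain A C where A: "A \<in> set st" "set A = set S" and C: "(A, C) \<in> (set R)\<^sup>*" "set C = set T"
    unfolding search_list_def same_set_iff using set_reachable[OF sub] by blast
  from C(1) have "(set A, set C) \<in> ?K\<^sup>*"
  proof (induction rule: rtrancl_induct)
    case (step B D)
    then have "B \<in> set st" "D \<in> set st" using sub by auto
    moreover from this have "set B \<in> set ` set st" "set D \<in> set ` set st" by auto
    ultimately have "(set B, set D) \<in> ?K" using R step.hyps(2) unfolding st by simp
    with step.IH show ?case by (rule rtrancl_into_rtrancl)
  qed simp
  then show "(set S, set T) \<in> ?K\<^sup>*" using A C by simp
next
  assume *: "(set S, set T) \<in> ?K\<^sup>*"
  have "set S \<in> set ` set st" unfolding st using S by simp
  then obtain A where A: "A \<in> set st" "set A = set S" by auto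
  have "\<exists>C. (A, C) \<in> (set R)\<^sup>* \<and> C \<in> set st \<and> set C = X" if "(set S, X) \<in> ?K\<^sup>*" for X
    using that
  proof (induction rule: rtrancl_induct)
    case base
    then show ?case using A by blast
  next
    case (step X Z)
    then obtain C where C: "(A, C) \<in> (set R)\<^sup>*" "C \<in> set st" "set C = X" by blast
    have "Z \<in> set ` set st" using step.hyps(2) unfolding st by simp
    then obtain D where D: "D \<in> set st" "set D = Z" by auto
    then have "(C, D) \<in> set R" using R C step.hyps(2) by simp
    then show ?case using rtrancl_into_rtrancl[OF C(1)] D by blast
  qed
  from this[OF *] obtain C where "(A, C) \<in> (set R)\<^sup>*" "set C = set T" by blast
  then show "search_list R st S T"
    unfolding search_list_def same_set_iff using set_reachable[OF sub A(1)] A by blast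
qed

lemma insert_list_iff:
  assumes "set C \<subseteq> {..<n}"
  shows "insert_list n A C \<longleftrightarrow> (\<exists>v. v \<notin> set A \<and> set C = insert v (set A))"
  using assms unfolding insert_list_def same_set_iff by auto

context alliance_pair
begin

lemma set_class_list:
  assumes "V = {..<n}" "E = set es" "F = set fs" "v < n"
  shows "set (class_list n k es fs v) = tok.cls v"
proof -
  let ?R = "filter (\<lambda>p. fst p \<in> set (idle_list n k es) \<and> snd p \<in> set (idle_list n k es)) fs"
  have "set ?R = F \<inter> I \<times> I"
    using assms by (auto simp: set_idle_list)
  moreover have "set ?R \<subseteq> set [0..<n] \<times> set [0..<n]"
    using F(2) assms by auto
  ultimately show ?thesis
    unfolding class_list_def tok.conn_def using set_reachable[of ?R "[0..<n]" v] assms(4) by simp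
qed

lemma set_kernel_list:
  assumes n: "V = {..<n}" "E = set es" "F = set fs" and ST: "S = set ss" "T = set ts"
  shows "set (kernel_list n k es fs ss ts) = U"
proof -
  have "length (filter (\<lambda>w. w < v) (class_list n k es fs v)) < k \<longleftrightarrow> v \<in> lowest k (tok.cls v)"
    if "v < n" for v
  proof -
    have "distinct (class_list n k es fs v)"
      unfolding class_list_def by (rule distinct_reachable) simp
    then show ?thesis
      using tok.cls_self[of v] unfolding lowest_def by (simp add: length_filter_distinct set_class_list[OF n that])
  qed
  then show ?thesis
    unfolding kernel_list_def kernel_def by (auto simp: set_class_list[OF n] n ST set_core_list)
qed

lemma mac_list_iff:
  assumes n: "V = {..<n}" "E = set es" "F = set fs" and "u < n" "v < n"
  shows "mac_list n k es fs u v \<longleftrightarrow> (u, v) \<in> tok.mac"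
proof -
  have "mac_list n k es fs u v \<longleftrightarrow> (\<exists>a b. (u, a) \<in> tok.conn \<and> (v, b) \<in> tok.conn \<and> (a = b \<or> (a, b) \<in> F))"
    unfolding mac_list_def set_class_list[OF n assms(4)] set_class_list[OF n assms(5)] n(3) by blast
  also have "\<dots> \<longleftrightarrow> (u, v) \<in> tok.mac"
    unfolding tok.mac_def using tok.conn_sym by blast
  finally show ?thesis .
qed

lemma step_list_iff:
  assumes n: "V = {..<n}" "E = set es" "F = set fs" and A: "set A \<subseteq> V" "set C \<subseteq> V"
  shows "step_list Y n k es fs A C \<longleftrightarrow>
    (if Y = TAR then reconf_step TAR E (set A) (set C) else swap tok.mac (set A) (set C))"
proof (cases "Y = TAR")
  case True
  then show ?thesis using A n(1) by (simp add: step_list_def insert_list_iff)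
next
  case False
  have "step_list Y n k es fs A C \<longleftrightarrow> (\<exists>u\<in>set A. \<exists>v\<in>{..<n}. v \<notin> set A \<and> mac_list n k es fs u v \<and>
      set C = insert v (set A - {u}))"
    using False unfolding step_list_def same_set_iff by (simp add: lessThan_atLeast0 set_diff_eq)
  also have "\<dots> \<longleftrightarrow> (\<exists>u\<in>set A. \<exists>v\<in>{..<n}. v \<notin> set A \<and> (u, v) \<in> tok.mac \<and>
      set C = insert v (set A - {u}))"
    using A(1) by (intro bex_cong refl) (auto simp: mac_list_iff[OF n] n(1))
  also have "\<dots> \<longleftrightarrow> swap tok.mac (set A) (set C)"
    using A(2) unfolding swap_def n(1) by blast
  finally show ?thesis using False by simp
qed

lemma reconf_list_iff:
  assumes n: "V = {..<n}" "E = set es" "F = set fs" and ST: "S = set ss" "T = set ts"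
    and M: "2 ^ card U \<le> M"
  shows "reconf_list Y M n k es fs (states_list M n k es (kernel_list n k es fs ss ts)) ss ts \<longleftrightarrow>
    (S, T) \<in> (if Y = TAR then tar_kernel else {(A, C). A \<subseteq> U \<and> C \<subseteq> U \<and> alliance A \<and> card A \<le> k \<and>
      alliance C \<and> card C \<le> k \<and> swap tok.mac A C})\<^sup>*"
proof -
  let ?K = "kernel_list n k es fs ss ts"
  let ?st = "states_list M n k es ?K"
  let ?P = "\<lambda>X. alliance X \<and> card X \<le> k"
  let ?s = "\<lambda>X Z. if Y = TAR then reconf_step TAR E X Z else swap tok.mac X Z"
  have K: "set ?K = U" "distinct ?K"
    using set_kernel_list[OF n ST] unfolding kernel_list_def by auto
  have UV: "U \<subseteq> V" by (rule kernel_facts)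
  have al: "alliance_list n es A \<and> card_list n A \<le> k \<longleftrightarrow> ?P (set A)" if "set A \<subseteq> U" for A
    using that UV n(1) alliance_list_iff[OF simple[unfolded n(1,2)], of A]
    unfolding n(2) by (auto simp: card_list_eq)
  have "2 ^ length ?K \<le> M" using M K distinct_card[of ?K] by simp
  note sub = sublists_upto_complete[OF this, THEN conjunct2, unfolded K(1)]
  have elem: "set A \<subseteq> U" if "A \<in> set (sublists_upto M ?K)" for A
    using sublists_upto_subset[OF that] K by simp
  have st: "set ` set ?st = {X. X \<subseteq> U \<and> ?P X}"
  proof (intro equalityI subsetI)
    fix X
    assume "X \<in> set ` set ?st"
    then obtain A where A: "A \<in> set ?st" "X = set A" by blast
    then have "set A \<subseteq> U" using elem unfolding states_list_def by auto
    then show "X \<in> {X. X \<subseteq> U \<and> ?P X}"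
      using A al[of A] unfolding states_list_def by simp
  next
    fix X
    assume X: "X \<in> {X. X \<subseteq> U \<and> ?P X}"
    then obtain A where "A \<in> set (sublists_upto M ?K)" "set A = X" using sub by blast
    then show "X \<in> set ` set ?st" using X al[of A] unfolding states_list_def by auto
  qed
  have stU: "set A \<subseteq> V" if "A \<in> set ?st" for A
    using elem that UV unfolding states_list_def by auto
  have "reconf_list Y M n k es fs ?st ss ts \<longleftrightarrow>
    (set ss, set ts) \<in> {(X, Z). X \<subseteq> U \<and> Z \<subseteq> U \<and> ?P X \<and> ?P Z \<and> ?s X Z}\<^sup>*"
    unfolding reconf_list_def
  proof (rule search_list_iff[OF st])
    fix A C
    assume AC: "A \<in> set ?st" "C \<in> set ?st"
    show "(A, C) \<in> set (filter (\<lambda>p. step_list Y n k es fs (fst p) (snd p)) (pairs ?st)) \<longleftrightarrow> ?s (set A) (set C)"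
      using AC step_list_iff[OF n stU[OF AC(1)] stU[OF AC(2)], of Y] by simp
  next
    show "set ss \<subseteq> U" using kernel_facts ST by simp
    show "?P (set ss)" using S ST by simp
  qed auto
  also have "{(X, Z). X \<subseteq> U \<and> Z \<subseteq> U \<and> ?P X \<and> ?P Z \<and> ?s X Z} =
    (if Y = TAR then tar_kernel else {(A, C). A \<subseteq> U \<and> C \<subseteq> U \<and> alliance A \<and> card A \<le> k \<and>
      alliance C \<and> card C \<le> k \<and> swap tok.mac A C})"
    unfolding tar_kernel_def tar_def by auto
  finally show ?thesis unfolding ST .
qed

end

text \<open>Under \<open>TAR\<close> it only shapes the kernel, whose size is then bounded as for
  jumping.\<close>

definition link :: "reconf_rule \<Rightarrow> 'a set \<Rightarrow> 'a rel \<Rightarrow> 'a rel" where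
  "link Y V E = (if Y = TS then E else V \<times> V)"

lemma alliance_pair_link:
  assumes "simple_graph V E" "global_offensive_alliance V E S" "global_offensive_alliance V E T"
    "card S \<le> k" "card T \<le> k"
  shows "alliance_pair V E k (link Y V E) S T"
  using assms by unfold_locales (auto simp: link_def simple_graph_def sym_def)

lemma goa_reconfigurable_iff:
  assumes "simple_graph V E" "global_offensive_alliance V E S" "card S \<le> k"
  shows "goa_reconfigurable Y k V E S T \<longleftrightarrow> (S, T) \<in>
    (if Y = TAR then {(A, C). global_offensive_alliance V E A \<and> card A \<le> k \<and>
        global_offensive_alliance V E C \<and> card C \<le> k \<and> reconf_step TAR E A C}
     else {(A, C). global_offensive_alliance V E A \<and> global_offensive_alliance V E C \<and>
        swap (link Y V E) A C})\<^sup>*"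
proof -
  let ?P = "\<lambda>A. global_offensive_alliance V E A \<and> (Y = TAR \<longrightarrow> card A \<le> k)"
  have fin: "A \<subseteq> V \<and> finite A" if "global_offensive_alliance V E A" for A
    using that assms(1) finite_subset
    unfolding global_offensive_alliance_def dominating_set_def simple_graph_def by blast
  have "goa_reconfigurable Y k V E S T \<longleftrightarrow> (S, T) \<in> {(A, C). ?P A \<and> ?P C \<and> reconf_step Y E A C}\<^sup>*"
    unfolding goa_reconfigurable_def
    using successively_iff_rtrancl[of S T ?P "reconf_step Y E"] assms by simp
  also have "{(A, C). ?P A \<and> ?P C \<and> reconf_step Y E A C} =
    (if Y = TAR then {(A, C). global_offensive_alliance V E A \<and> card A \<le> k \<and>
        global_offensive_alliance V E C \<and> card C \<le> k \<and> reconf_step TAR E A C}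
     else {(A, C). global_offensive_alliance V E A \<and> global_offensive_alliance V E C \<and>
        swap (link Y V E) A C})"
  proof (cases Y)
    case TJ
    have "reconf_step TJ E A C \<longleftrightarrow> swap (V \<times> V) A C"
      if "global_offensive_alliance V E A" "global_offensive_alliance V E C" for A C
      using fin[OF that(1)] fin[OF that(2)] by (intro reconf_step_TJ_iff_swap) auto
    then show ?thesis using TJ by (auto simp: link_def simp del: reconf_step.simps)
  next
    case TS
    have "reconf_step TS E A C \<longleftrightarrow> swap E A C"
      if "global_offensive_alliance V E A" "global_offensive_alliance V E C" for A C
      using fin[OF that(1)] fin[OF that(2)] by (intro reconf_step_TS_iff_swap) auto
    then show ?thesis using TS by (auto simp: link_def simp del: reconf_step.simps)
  next
    case TAR
    then show ?thesis by (auto simp del: reconf_step.simps)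
  qed
  finally show ?thesis .
qed

lemma reconf_list_correct:
  assumes simple: "simple_graph {..<n} (set es)"
    and S: "global_offensive_alliance {..<n} (set es) (set ss)" "card (set ss) \<le> k"
    and T: "global_offensive_alliance {..<n} (set es) (set ts)" "card (set ts) \<le> k"
    and M: "2 ^ 2 ^ (5 * k + 5) \<le> M"
  shows "reconf_list Y M n k es (link_list Y n es)
      (states_list M n k es (kernel_list n k es (link_list Y n es) ss ts)) ss ts \<longleftrightarrow>
    goa_reconfigurable Y k {..<n} (set es) (set ss) (set ts)"
proof -
  interpret alliance_pair "{..<n}" "set es" k "link Y {..<n} (set es)" "set ss" "set ts"
    using alliance_pair_link[OF simple S(1) T(1) S(2) T(2)] .
  have F: "link Y {..<n} (set es) = set (link_list Y n es)"
    unfolding link_def link_list_def by (auto simp: lessThan_atLeast0)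
  have "card U \<le> k + k + 4 * k ^ 3 + (4 * k ^ 3 * (2 * k) + k + 4 * k ^ 3 + 1) * k"
  proof (cases "Y = TS")
    case True
    then have "card U \<le> k + k + 4 * k ^ 3 + (4 * k ^ 3 * (2 * k)) * k"
      by (intro card_kernel_sliding) (simp add: link_def)
    then show ?thesis by (simp add: algebra_simps)
  next
    case False
    then have "card U \<le> k + k + 4 * k ^ 3 + (k + 4 * k ^ 3 + 1) * k"
      by (intro card_kernel_jumping) (simp add: link_def)
    then show ?thesis by (simp add: algebra_simps)
  qed
  also note poly_le_exp
  finally have "(2::nat) ^ card U \<le> 2 ^ 2 ^ (5 * k + 5)" by (rule power_increasing) simp
  then have "2 ^ card U \<le> M" using M by (rule order_trans)
  from reconf_list_iff[OF refl refl F refl refl this, of Y] show ?thesis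
    unfolding goa_reconfigurable_iff[OF simple S]
    using swap_equiv tar_equiv unfolding tar_def by simp
qed

text \<open>Under \<open>TAR\<close> the procedure does not test the sizes of start and target
  separately: a set larger than \<open>k\<close> is not among the states, so the search fails, as it
  should.\<close>

lemma reconf_list_size:
  assumes simple: "simple_graph {..<n} (set es)"
    and "reconf_list Y M n k es fs (states_list M n k es U) ss ts"
  shows "card (set ss) \<le> k" "card (set ts) \<le> k"
proof -
  let ?st = "states_list M n k es U"
  let ?R = "filter (\<lambda>p. step_list Y n k es fs (fst p) (snd p)) (pairs ?st)"
  have R: "set ?R \<subseteq> set ?st \<times> set ?st" by auto
  from assms(2) obtain A C where A: "A \<in> set ?st" "set A = set ss"
    and C: "(A, C) \<in> (set ?R)\<^sup>*" "set C = set ts"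
    unfolding reconf_list_def search_list_def same_set_iff using set_reachable[OF R] by blast
  from C(1) have "C \<in> set ?st"
    by (induction rule: rtrancl_induct) (use A R in auto)
  moreover have "card (set B) \<le> k" if "B \<in> set ?st" for B
    using that alliance_card_list[of n es B] unfolding states_list_def by auto
  ultimately show "card (set ss) \<le> k" "card (set ts) \<le> k" using A C by metis+
qed

lemma goa_reconfigurable_size:
  assumes "goa_reconfigurable TAR k V E S T"
  shows "card S \<le> k" "card T \<le> k"
  using assms unfolding goa_reconfigurable_def by auto

lemma solves_list_iff:
  assumes M: "2 ^ 2 ^ (5 * k + 5) \<le> M"
  shows "solves_list Y M n k es ss ts \<longleftrightarrow>
    simple_graph {..<n} (set es) \<and> global_offensive_alliance {..<n} (set es) (set ss) \<and>
    global_offensive_alliance {..<n} (set es) (set ts) \<and>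
    (Y \<in> {TJ, TS} \<longrightarrow> card (set ss) = k \<and> card (set ts) = k) \<and>
    goa_reconfigurable Y k {..<n} (set es) (set ss) (set ts)"
proof (cases "simple_graph {..<n} (set es) \<and> global_offensive_alliance {..<n} (set es) (set ss) \<and>
    global_offensive_alliance {..<n} (set es) (set ts)")
  case False
  then show ?thesis unfolding solves_list_def simple_list_iff using alliance_list_iff by blast
next
  case True
  then have al: "simple_list n es" "alliance_list n es ss" "alliance_list n es ts"
    using simple_list_iff alliance_list_iff by auto
  then have sz: "card_list n ss = card (set ss)" "card_list n ts = card (set ts)"
    by (auto intro: alliance_card_list)
  have Y: "Y \<in> {TJ, TS} \<longleftrightarrow> Y \<noteq> TAR" by (cases Y) auto
  show ?thesis
  proof (cases "card (set ss) \<le> k \<and> card (set ts) \<le> k")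
    case le: True
    then have "reconf_list Y M n k es (link_list Y n es)
        (states_list M n k es (kernel_list n k es (link_list Y n es) ss ts)) ss ts \<longleftrightarrow>
      goa_reconfigurable Y k {..<n} (set es) (set ss) (set ts)"
      using True M by (intro reconf_list_correct) auto
    then show ?thesis unfolding solves_list_def sz Y using True al by simp
  next
    case False
    then have "\<not> reconf_list Y M n k es (link_list Y n es)
        (states_list M n k es (kernel_list n k es (link_list Y n es) ss ts)) ss ts"
      using True reconf_list_size by blast
    moreover have "Y \<noteq> TAR \<longrightarrow> \<not> (card (set ss) = k \<and> card (set ts) = k)"
      using False by auto
    moreover have "Y = TAR \<longrightarrow> \<not> goa_reconfigurable Y k {..<n} (set es) (set ss) (set ts)"
      using False goa_reconfigurable_size by blast
    ultimately show ?thesis unfolding solves_list_def Y by blast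
  qed
qed

text \<open>In one direction the equation tested by \<open>decide\<close> exhibits the decoded data
  as an instance; in the other, \<open>decode_encode\<close> recovers the given one.\<close>

lemma decide_iff:
  assumes M: "2 ^ 2 ^ (5 * k + 5) \<le> M"
  shows "decide Y (x, k, M) \<longleftrightarrow> (x, k) \<in> GOA_Reconf Y"
proof
  assume "decide Y (x, k, M)"
  then show "(x, k) \<in> GOA_Reconf Y"
    unfolding decide_def GOA_Reconf_def fst_conv snd_conv solves_list_iff[OF M] by blast
next
  assume "(x, k) \<in> GOA_Reconf Y"
  then obtain n E S T where x: "x = encode n E S T" and sol: "simple_graph {..<n} E"
    "global_offensive_alliance {..<n} E S" "global_offensive_alliance {..<n} E T"
    "Y \<in> {TJ, TS} \<longrightarrow> card S = k \<and> card T = k" "goa_reconfigurable Y k {..<n} E S T"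
    unfolding GOA_Reconf_def by blast
  have sub: "E \<subseteq> {..<n} \<times> {..<n}" "S \<subseteq> {..<n}" "T \<subseteq> {..<n}"
    using sol(1-3) unfolding simple_graph_def global_offensive_alliance_def dominating_set_def by auto
  have "n \<in> set [0..<Suc (length x)]" unfolding x length_encode by (simp del: upt_Suc)
  then show "decide Y (x, k, M)"
    unfolding decide_def fst_conv snd_conv solves_list_iff[OF M]
    using sol x decode_encode[OF sub] by (intro bexI[of _ n]) auto
qed

theorem theorem8:
  fixes Y :: reconf_rule
  shows "fixed_parameter_tractable (GOA_Reconf Y)"
proof (rule fixed_parameter_tractableI)
  show "polytime (decide Y)" by (rule polytime_decide)
  show "polytime (\<lambda>k::nat. 5 * k + 5)" by (intro polytime_intros)
  show "decide Y (x, k, 2 ^ 2 ^ (5 * k + 5)) \<longleftrightarrow> (x, k) \<in> GOA_Reconf Y" for x k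
    by (rule decide_iff) simp
qed simp

end
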